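(* Let $I\in\mathfrak{Ab}$ be an abelian ideal with shift vector $\mathbf k_I=(k_0,k_1,\dots,k_n)$. Then, in the poset $\mathfrak{Ab}$, $\kappa(I)=\#\{i: k_i=-1\}$ and $\iota(I)=\#\{i:k_i=1\}$.
   Context: Let $\Delta$ be an irreducible reduced root system in a real Euclidean space $V$, positive roots $\Delta^+$, simple roots $\Pi=\{\alpha_1,\dots,\alpha_n\}$, highest root $\theta$, with $\Delta^+$ ordered by the root order ($\gamma$ covers $\mu$ iff $\gamma-\mu\in\Pi$). An upper ideal $I\subset\Delta^+$ (up-closed subset) is abelian if $\gamma'+\gamma''\notin\Delta^+$ for all $\gamma',\gamma''\in I$; $\mathfrak{Ab}$ is the poset of abelian upper ideals (including $\varnothing$) ordered by inclusion. For $x$ in a finite poset, $\kappa(x)$ (resp. $\iota(x)$) is the number of elements covered by (resp. covering) $x$. Let $\widehat V=V\oplus\mathbb R\delta\oplus\mathbb R\lambda$ with inner product extended by $(\delta,V)=(\lambda,V)=(\delta,\delta)=(\lambda,\lambda)=0$, $(\delta,\lambda)=1$; positive affine roots $\widehat\Delta^+=\Delta^+\cup\{\mu+k\delta:\mu\in\Delta,k\ge1\}$; affine simple roots $\alpha_0=\delta-\theta,\alpha_1,\dots,\alpha_n$; affine Weyl group $\widehat W$ generated by $s_i(x)=x-(x,\alpha_i^\vee)\alpha_i$, $\alpha^\vee=2\alpha/(\alpha,\alpha)$. For $w\in\widehat W$, $N(w)=\{\nu\in\widehat\Delta^+:w(\nu)\in-\widehat\Delta^+\}$; $w$ is minuscule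 if $N(w)=\{\delta-\gamma:\gamma\in I\}$ for some $I\subset\Delta$. It is known (Peterson) that $I\mapsto w_I$ gives a bijection between $\mathfrak{Ab}$ and the minuscule elements, where $N(w_I)=\{\delta-\gamma:\gamma\in I\}$. The shift vector $\mathbf k_I=(k_0,\dots,k_n)$ is defined by $w_I^{-1}(\alpha_i)=-\mu_i+k_i\delta$ with $\mu_i\in\Delta$, $k_i\in\mathbb Z$. *)

theory Defs
  imports "HOL-Analysis.Analysis"
begin

section \<open>Finite root systems\<close>

text \<open>Root systems are crystallographic, as in Lie theory.\<close>

definition root_system :: "'a::euclidean_space set \<Rightarrow> bool" where
  "root_system \<Delta> \<longleftrightarrow>
     finite \<Delta> \<and> 0 \<notin> \<Delta> \<and> span \<Delta> = UNIV \<and>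
     (\<forall>\<alpha>\<in>\<Delta>. \<forall>\<beta>\<in>\<Delta>. \<beta> - (2 * (\<beta> \<bullet> \<alpha>) / (\<alpha> \<bullet> \<alpha>)) *\<^sub>R \<alpha> \<in> \<Delta>) \<and>
     (\<forall>\<alpha>\<in>\<Delta>. \<forall>\<beta>\<in>\<Delta>. 2 * (\<beta> \<bullet> \<alpha>) / (\<alpha> \<bullet> \<alpha>) \<in> \<int>)"

definition reduced_roots :: "'a::euclidean_space set \<Rightarrow> bool" where
  "reduced_roots \<Delta> \<longleftrightarrow> (\<forall>\<alpha>\<in>\<Delta>. \<forall>c. c *\<^sub>R \<alpha> \<in> \<Delta> \<longrightarrow> c = 1 \<or> c = -1)"

definition irreducible_roots :: "'a::euclidean_space set \<Rightarrow> bool" where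
  "irreducible_roots \<Delta> \<longleftrightarrow>
     \<Delta> \<noteq> {} \<and>
     \<not> (\<exists>A B. A \<noteq> {} \<and> B \<noteq> {} \<and> A \<inter> B = {} \<and> A \<union> B = \<Delta> \<and> (\<forall>a\<in>A. \<forall>b\<in>B. a \<bullet> b = 0))"

definition pos_roots :: "'a::euclidean_space set \<Rightarrow> 'a set \<Rightarrow> 'a set" where
  "pos_roots \<Delta> S = {\<beta>\<in>\<Delta>. \<exists>c::'a \<Rightarrow> nat. \<beta> = (\<Sum>\<alpha>\<in>S. real (c \<alpha>) *\<^sub>R \<alpha>)}"

definition simple_roots :: "'a::euclidean_space set \<Rightarrow> 'a set \<Rightarrow> bool" where
  "simple_roots \<Delta> S \<longleftrightarrow>
     S \<subseteq> \<Delta> \<and> independent S \<and> (\<forall>\<beta>\<in>\<Delta>. \<beta> \<in> pos_roots \<Delta> S \<or> - \<beta> \<in> pos_roots \<Delta> S)"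

text \<open>The order on the positive roots is generated by its covering relation.\<close>

definition root_order :: "'a::euclidean_space set \<Rightarrow> 'a set \<Rightarrow> ('a \<times> 'a) set" where
  "root_order \<Delta> S =
     {(\<mu>, \<gamma>). \<mu> \<in> pos_roots \<Delta> S \<and> \<gamma> \<in> pos_roots \<Delta> S \<and> \<gamma> - \<mu> \<in> S}\<^sup>*"

definition highest_root :: "'a::euclidean_space set \<Rightarrow> 'a set \<Rightarrow> 'a \<Rightarrow> bool" where
  "highest_root \<Delta> S \<theta> \<longleftrightarrow>
     \<theta> \<in> pos_roots \<Delta> S \<and> (\<forall>\<gamma>\<in>pos_roots \<Delta> S. (\<gamma>, \<theta>) \<in> root_order \<Delta> S)"

section \<open>Abelian ideals\<close>

definition upper_ideal :: "'a::euclidean_space set \<Rightarrow> 'a set \<Rightarrow> 'a set \<Rightarrow> bool" where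
  "upper_ideal \<Delta> S I \<longleftrightarrow>
     I \<subseteq> pos_roots \<Delta> S \<and>
     (\<forall>\<mu>\<in>I. \<forall>\<gamma>\<in>pos_roots \<Delta> S. (\<mu>, \<gamma>) \<in> root_order \<Delta> S \<longrightarrow> \<gamma> \<in> I)"

definition abelian_ideals :: "'a::euclidean_space set \<Rightarrow> 'a set \<Rightarrow> 'a set set" where
  "abelian_ideals \<Delta> S =
     {I. upper_ideal \<Delta> S I \<and> (\<forall>\<gamma>\<in>I. \<forall>\<gamma>'\<in>I. \<gamma> + \<gamma>' \<notin> pos_roots \<Delta> S)}"

text \<open>For a subset \<open>P\<close> of an ordered type, with the induced order; it is applied to
  \<^term>\<open>abelian_ideals \<Delta> S\<close>, where the order is inclusion.\<close>

definition covers_in :: "'b::order set \<Rightarrow> 'b \<Rightarrow> 'b \<Rightarrow> bool" where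
  "covers_in P y x \<longleftrightarrow> x \<in> P \<and> y \<in> P \<and> x < y \<and> \<not> (\<exists>z\<in>P. x < z \<and> z < y)"

definition kappa :: "'b::order set \<Rightarrow> 'b \<Rightarrow> nat" where
  "kappa P x = card {y. covers_in P x y}"

definition iota :: "'b::order set \<Rightarrow> 'b \<Rightarrow> nat" where
  "iota P x = card {y. covers_in P y x}"

section \<open>Affine roots and the affine Weyl group\<close>

text \<open>The triple \<open>(v, a, b)\<close> stands for \<open>v + a \<delta> + b \<lambda>\<close>. The bilinear form is
  \<open>affine_form\<close> below, not the Euclidean inner product of the product type.\<close>

type_synonym 'a affine_space = "'a \<times> real \<times> real"

definition affine_form :: "'a::euclidean_space affine_space \<Rightarrow> 'a affine_space \<Rightarrow> real" where
  "affine_form = (\<lambda>(v, a, b) (v', a', b'). v \<bullet> v' + a * b' + b * a')"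

definition embed :: "'a::euclidean_space \<Rightarrow> 'a affine_space" where
  "embed v = (v, 0, 0)"

definition delta :: "'a::euclidean_space affine_space" where
  "delta = (0, 1, 0)"

definition affine_pos_roots :: "'a::euclidean_space set \<Rightarrow> 'a set \<Rightarrow> 'a affine_space set" where
  "affine_pos_roots \<Delta> S =
     embed ` pos_roots \<Delta> S \<union> {embed \<mu> + real k *\<^sub>R delta | \<mu> k. \<mu> \<in> \<Delta> \<and> k \<ge> 1}"

text \<open>The simple roots \<open>\<alpha> 1, \<dots>, \<alpha> n\<close> are extended by the affine one at index 0;
  the value of \<open>\<alpha>\<close> at 0 is not used.\<close>

definition affine_simple :: "(nat \<Rightarrow> 'a::euclidean_space) \<Rightarrow> 'a \<Rightarrow> nat \<Rightarrow> 'a affine_space" where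
  "affine_simple \<alpha> \<theta> i = (if i = 0 then delta - embed \<theta> else embed (\<alpha> i))"

definition coroot :: "'a::euclidean_space affine_space \<Rightarrow> 'a affine_space" where
  "coroot a = (2 / affine_form a a) *\<^sub>R a"

definition reflect :: "'a::euclidean_space affine_space \<Rightarrow> 'a affine_space \<Rightarrow> 'a affine_space" where
  "reflect a x = x - affine_form x (coroot a) *\<^sub>R a"

text \<open>The generators are involutions, so the monoid they generate is the group they generate.\<close>

lemma reflect_involution:
  assumes "affine_form a a \<noteq> 0"
  shows "reflect a (reflect a x) = x"
proof -
  have lin: "affine_form (x - t *\<^sub>R y) z = affine_form x z - t * affine_form y z"
    for t :: real and x y z :: "'a affine_space"
    by (auto simp: affine_form_def split_beta inner_diff_left algebra_simps)
  have "affine_form a (t *\<^sub>R a) = t * affine_form a a" for t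
    by (auto simp: affine_form_def split_beta algebra_simps)
  then have "affine_form a (coroot a) = 2"
    using assms by (simp add: coroot_def)
  then show ?thesis
    by (simp add: reflect_def lin flip: scaleR_add_left scaleR_left_diff_distrib)
qed

inductive_set affine_weyl ::
    "nat \<Rightarrow> (nat \<Rightarrow> 'a::euclidean_space) \<Rightarrow> 'a \<Rightarrow> ('a affine_space \<Rightarrow> 'a affine_space) set"
  for n :: nat and \<alpha> :: "nat \<Rightarrow> 'a" and \<theta> :: 'a where
  one: "id \<in> affine_weyl n \<alpha> \<theta>"
| step: "i \<le> n \<Longrightarrow> w \<in> affine_weyl n \<alpha> \<theta> \<Longrightarrow>
    reflect (affine_simple \<alpha> \<theta> i) \<circ> w \<in> affine_weyl n \<alpha> \<theta>"

definition inversions ::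
    "'a::euclidean_space set \<Rightarrow> 'a set \<Rightarrow> ('a affine_space \<Rightarrow> 'a affine_space) \<Rightarrow> 'a affine_space set"
  where
  "inversions \<Delta> S w = {\<nu>\<in>affine_pos_roots \<Delta> S. w \<nu> \<in> uminus ` affine_pos_roots \<Delta> S}"

section \<open>Minuscule elements and shift vectors\<close>

definition minuscule ::
    "'a::euclidean_space set \<Rightarrow> nat \<Rightarrow> (nat \<Rightarrow> 'a) \<Rightarrow> 'a \<Rightarrow> ('a affine_space \<Rightarrow> 'a affine_space) \<Rightarrow> bool"
  where
  "minuscule \<Delta> n \<alpha> \<theta> w \<longleftrightarrow>
     w \<in> affine_weyl n \<alpha> \<theta> \<and>
     (\<exists>I\<subseteq>\<Delta>. inversions \<Delta> (\<alpha> ` {1..n}) w = {delta - embed \<gamma> | \<gamma>. \<gamma> \<in> I})"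

text \<open>For an abelian ideal \<open>I\<close> this element exists and is unique by Peterson's theorem.\<close>

definition minuscule_of ::
    "'a::euclidean_space set \<Rightarrow> nat \<Rightarrow> (nat \<Rightarrow> 'a) \<Rightarrow> 'a \<Rightarrow> 'a set \<Rightarrow> 'a affine_space \<Rightarrow> 'a affine_space"
  where
  "minuscule_of \<Delta> n \<alpha> \<theta> I =
     (THE w. minuscule \<Delta> n \<alpha> \<theta> w \<and>
             inversions \<Delta> (\<alpha> ` {1..n}) w = {delta - embed \<gamma> | \<gamma>. \<gamma> \<in> I})"

text \<open>The shift of \<open>I\<close> at \<open>i\<close> is meaningful for \<open>i \<le> n\<close>; it is unique because it is the
  \<open>\<delta>\<close>-coordinate of the root on the left.\<close>

definition shift ::
    "'a::euclidean_space set \<Rightarrow> nat \<Rightarrow> (nat \<Rightarrow> 'a) \<Rightarrow> 'a \<Rightarrow> 'a set \<Rightarrow> nat \<Rightarrow> int"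
  where
  "shift \<Delta> n \<alpha> \<theta> I i =
     (THE k. \<exists>\<mu>\<in>\<Delta>. inv (minuscule_of \<Delta> n \<alpha> \<theta> I) (affine_simple \<alpha> \<theta> i)
                      = - embed \<mu> + real_of_int k *\<^sub>R delta)"

end

theory Submission
  imports Defs
begin

text \<open>The covers of \<open>I\<close> are obtained by removing or adding a single root \<open>\<gamma>\<close>. If \<open>J\<close> and
  \<open>J \<union> {\<gamma>}\<close> are abelian ideals, then \<open>w\<^sub>J(\<delta> - \<gamma>)\<close> is a simple root \<open>\<alpha>\<^sub>i\<close>: otherwise it is
  \<open>\<alpha>\<^sub>i\<close> plus a positive (possibly imaginary) root, and pulling back this splitting to
  \<open>\<delta> - \<gamma>\<close> contradicts the choice of \<open>\<gamma>\<close>. Hence \<open>w = s\<^sub>i w\<^sub>J\<close> is the minuscule element of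
  \<open>J \<union> {\<gamma>}\<close>, and \<open>w\<inverse>(\<alpha>\<^sub>i) = \<gamma> - \<delta>\<close>; this also yields the existence of all minuscule elements
  by induction. Conversely, if \<open>w\<^sub>I\<inverse>(\<alpha>\<^sub>i) = \<plusminus>(\<delta> - \<gamma>)\<close>, then adding or removing \<open>\<gamma>\<close> keeps \<open>I\<close> an
  abelian ideal, because a violation would write \<open>\<alpha>\<^sub>i\<close> as a sum of two positive roots.\<close>

section \<open>Finite root systems\<close>

lemma root_uminus:
  assumes "root_system \<Delta>" "\<mu> \<in> \<Delta>"
  shows "- \<mu> \<in> \<Delta>"
proof -
  have "\<mu> - (2 * (\<mu> \<bullet> \<mu>) / (\<mu> \<bullet> \<mu>)) *\<^sub>R \<mu> \<in> \<Delta>" and "\<mu> \<noteq> 0"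
    using assms unfolding root_system_def by blast+
  then show ?thesis
    by (simp add: scaleR_2)
qed

text \<open>The Cartan integers \<open>p\<close> and \<open>q\<close> are positive. If one of them
  is 1, a reflection gives the difference up to sign; if both are at least 2, the squared norm of
  \<open>\<mu> - \<nu>\<close> is at most 0.\<close>

lemma root_diff:
  fixes \<mu> \<nu> :: "'a::euclidean_space"
  assumes "root_system \<Delta>" "\<mu> \<in> \<Delta>" "\<nu> \<in> \<Delta>" "\<mu> \<bullet> \<nu> > 0" "\<mu> \<noteq> \<nu>"
  shows "\<mu> - \<nu> \<in> \<Delta>"
proof -
  define p where "p = 2 * (\<mu> \<bullet> \<nu>) / (\<nu> \<bullet> \<nu>)"
  define q where "q = 2 * (\<nu> \<bullet> \<mu>) / (\<mu> \<bullet> \<mu>)"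
  have refl: "\<mu> - p *\<^sub>R \<nu> \<in> \<Delta>" "\<nu> - q *\<^sub>R \<mu> \<in> \<Delta>" and ints: "p \<in> \<int>" "q \<in> \<int>"
    and "\<mu> \<noteq> 0" "\<nu> \<noteq> 0"
    using assms unfolding root_system_def p_def q_def by auto
  then have norms: "\<mu> \<bullet> \<mu> > 0" "\<nu> \<bullet> \<nu> > 0"
    by auto
  then have "p > 0" "q > 0"
    using assms(4) by (auto simp: p_def q_def inner_commute)
  moreover obtain i j where ij: "p = of_int i" "q = of_int j"
    using ints by (elim Ints_cases)
  ultimately have "i > 0" "j > 0"
    by auto
  consider "p = 1" | "q = 1" | "p \<ge> 2" "q \<ge> 2"
    using \<open>i > 0\<close> \<open>j > 0\<close> ij by force
  then show ?thesis
  proof cases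
    case 1
    then show ?thesis using refl by simp
  next
    case 2
    then show ?thesis using refl root_uminus[OF assms(1), of "\<nu> - \<mu>"] by simp
  next
    case 3
    then have "\<mu> \<bullet> \<nu> \<ge> \<nu> \<bullet> \<nu>" "\<mu> \<bullet> \<nu> \<ge> \<mu> \<bullet> \<mu>"
      using norms by (auto simp: p_def q_def field_simps inner_commute)
    then have "(\<mu> - \<nu>) \<bullet> (\<mu> - \<nu>) \<le> 0"
      by (simp add: inner_diff_left inner_diff_right inner_commute)
    then show ?thesis
      using assms(5) by (metis eq_iff_diff_eq_0 inner_ge_zero inner_eq_zero_iff order_antisym)
  qed
qed

section \<open>Heights\<close>

locale affine_root_datum =
  fixes \<Delta> S :: "'a::euclidean_space set" and n :: nat and \<alpha> :: "nat \<Rightarrow> 'a" and \<theta> :: 'a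
  assumes root_system: "root_system \<Delta>"
    and reduced: "reduced_roots \<Delta>"
    and simple: "simple_roots \<Delta> S"
    and S_eq: "S = \<alpha> ` {1..n}"
    and inj: "inj_on \<alpha> {1..n}"
    and highest: "highest_root \<Delta> S \<theta>"
begin

abbreviation Pos :: "'a set" where "Pos \<equiv> pos_roots \<Delta> S"

abbreviation Ab :: "'a set set" where "Ab \<equiv> abelian_ideals \<Delta> S"

lemma finite_roots: "finite \<Delta>"
  and zero_notin_roots: "0 \<notin> \<Delta>"
  using root_system by (auto simp: root_system_def)

lemma uminus_root_iff: "- \<mu> \<in> \<Delta> \<longleftrightarrow> \<mu> \<in> \<Delta>"
  using root_uminus[OF root_system] by (metis minus_minus)

lemma finite_S: "finite S"
  by (simp add: S_eq)

lemma S_subset: "S \<subseteq> \<Delta>"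
  and independent_S: "independent S"
  and pos_or_neg: "\<mu> \<in> \<Delta> \<Longrightarrow> \<mu> \<in> Pos \<or> - \<mu> \<in> Pos"
  using simple by (auto simp: simple_roots_def)

lemma Pos_subset: "Pos \<subseteq> \<Delta>"
  by (auto simp: pos_roots_def)

lemma finite_Pos: "finite Pos"
  using Pos_subset finite_roots finite_subset by blast

text \<open>Unlike \<open>pos_roots\<close>, this set is closed under addition, so positivity of a
  sum of positive roots reduces to its being a root.\<close>

definition root_cone :: "'a set" where
  "root_cone = range (\<lambda>c::'a \<Rightarrow> nat. \<Sum>s\<in>S. real (c s) *\<^sub>R s)"

lemma root_cone_add:
  assumes "x \<in> root_cone" "y \<in> root_cone"
  shows "x + y \<in> root_cone"
proof -
  obtain c d :: "'a \<Rightarrow> nat" where "x = (\<Sum>s\<in>S. real (c s) *\<^sub>R s)" "y = (\<Sum>s\<in>S. real (d s) *\<^sub>R s)"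
    using assms unfolding root_cone_def by auto
  then have "x + y = (\<Sum>s\<in>S. real (c s + d s) *\<^sub>R s)"
    by (simp add: sum.distrib scaleR_add_left)
  then show ?thesis
    unfolding root_cone_def by (rule range_eqI[of _ _ "\<lambda>s. c s + d s"])
qed

lemma zero_in_root_cone: "0 \<in> root_cone"
  unfolding root_cone_def by (rule range_eqI[of _ _ "\<lambda>_. 0"]) simp

lemma simple_in_root_cone:
  assumes "s \<in> S"
  shows "s \<in> root_cone"
proof -
  have "(\<Sum>t\<in>S. real (if t = s then 1 else 0) *\<^sub>R t) = (\<Sum>t\<in>S. if t = s then t else 0)"
    by (rule sum.cong) auto
  then have "s = (\<Sum>t\<in>S. real (if t = s then 1 else 0) *\<^sub>R t)"
    using assms finite_S by simp
  then show ?thesis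
    unfolding root_cone_def by (rule range_eqI[of _ _ "\<lambda>t. if t = s then 1 else 0"])
qed

lemma Pos_iff_cone: "\<mu> \<in> Pos \<longleftrightarrow> \<mu> \<in> \<Delta> \<and> \<mu> \<in> root_cone"
  by (auto simp: pos_roots_def root_cone_def)

lemma S_subset_Pos: "S \<subseteq> Pos"
  using simple_in_root_cone S_subset by (auto simp: Pos_iff_cone)

text \<open>A linear functional on the whole space, so that it also applies to differences that need
  not be roots; one exists by independence of \<open>S\<close>.\<close>

definition height :: "'a \<Rightarrow> real" where
  "height = (SOME f. linear f \<and> (\<forall>s\<in>S. f s = 1))"

lemma linear_height: "linear height"
  and height_simple: "s \<in> S \<Longrightarrow> height s = 1"
proof -
  have "\<exists>f::'a \<Rightarrow> real. linear f \<and> (\<forall>s\<in>S. f s = 1)"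
    using linear_independent_extend[OF independent_S, of "\<lambda>_. 1"] by auto
  then have "linear height \<and> (\<forall>s\<in>S. height s = 1)"
    unfolding height_def by (rule someI_ex)
  then show "linear height" "s \<in> S \<Longrightarrow> height s = 1"
    by auto
qed

lemmas height_linear_simps =
  linear_add[OF linear_height] linear_diff[OF linear_height] linear_neg[OF linear_height]
  linear_0[OF linear_height] linear_cmul[OF linear_height]

lemma height_sum: "height (\<Sum>s\<in>S. c s *\<^sub>R s) = (\<Sum>s\<in>S. c s)"
  using height_simple by (simp add: linear_sum[OF linear_height] height_linear_simps)

lemma height_cone: "x \<in> root_cone \<Longrightarrow> height x \<in> \<nat>"
  unfolding root_cone_def by (auto simp: height_sum simp flip: of_nat_sum)

lemma height_cone_pos:
  assumes "x \<in> root_cone" "x \<noteq> 0"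
  shows "height x \<ge> 1"
proof -
  obtain c :: "'a \<Rightarrow> nat" where c: "x = (\<Sum>s\<in>S. real (c s) *\<^sub>R s)"
    using assms unfolding root_cone_def by auto
  then have "\<exists>s\<in>S. c s \<noteq> 0"
    using assms(2) by (metis (no_types, lifting) of_nat_0 scaleR_zero_left sum.neutral)
  then have "sum c S \<noteq> 0"
    using finite_S by auto
  then show ?thesis
    using c by (simp add: height_sum flip: of_nat_sum)
qed

lemma height_Pos: "\<mu> \<in> Pos \<Longrightarrow> height \<mu> \<ge> 1"
  using height_cone_pos zero_notin_roots by (metis Pos_iff_cone)

lemma Pos_iff_height: "\<mu> \<in> \<Delta> \<Longrightarrow> \<mu> \<in> Pos \<longleftrightarrow> height \<mu> > 0"
  using height_Pos[of \<mu>] height_Pos[of "- \<mu>"] pos_or_neg[of \<mu>]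
  by (auto simp: height_linear_simps)

lemma height_root_Ints:
  assumes "\<mu> \<in> \<Delta>"
  shows "height \<mu> \<in> \<int>"
proof -
  consider "\<mu> \<in> root_cone" | "- \<mu> \<in> root_cone"
    using assms pos_or_neg by (auto simp: Pos_iff_cone)
  then show ?thesis
  proof cases
    case 1
    then show ?thesis using height_cone Nats_subset_Ints by blast
  next
    case 2
    then have "height (- \<mu>) \<in> \<int>" using height_cone Nats_subset_Ints by blast
    then show ?thesis by (simp add: height_linear_simps)
  qed
qed

lemma height_root_neq_0: "\<mu> \<in> \<Delta> \<Longrightarrow> height \<mu> \<noteq> 0"
  using height_Pos[of \<mu>] height_Pos[of "- \<mu>"] pos_or_neg[of \<mu>]
  by (auto simp: height_linear_simps)

section \<open>The root order\<close>

lemma root_order_step: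
  assumes "\<mu> \<in> Pos" "s \<in> S" "\<mu> + s \<in> \<Delta>"
  shows "(\<mu>, \<mu> + s) \<in> root_order \<Delta> S"
proof -
  have "height (\<mu> + s) > 0"
    using height_Pos[OF assms(1)] height_simple[OF assms(2)] by (simp add: height_linear_simps)
  then show ?thesis
    unfolding root_order_def using assms by (intro r_into_rtrancl) (simp add: Pos_iff_height)
qed

lemma root_order_trans:
  "(\<mu>, \<nu>) \<in> root_order \<Delta> S \<Longrightarrow> (\<nu>, \<gamma>) \<in> root_order \<Delta> S \<Longrightarrow> (\<mu>, \<gamma>) \<in> root_order \<Delta> S"
  unfolding root_order_def by (rule rtrancl_trans)

lemma root_order_diff_cone:
  assumes "(\<mu>, \<gamma>) \<in> root_order \<Delta> S"
  shows "\<gamma> - \<mu> \<in> root_cone"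
  using assms unfolding root_order_def
proof (induction rule: rtrancl_induct)
  case base
  then show ?case by (simp add: zero_in_root_cone)
next
  case (step \<nu> \<gamma>)
  then have "\<gamma> - \<nu> \<in> root_cone"
    by (simp add: simple_in_root_cone)
  from root_cone_add[OF this step.IH] show ?case by simp
qed

text \<open>Induction on the sum of the coefficients of d = \<gamma> - \<mu>. Some simple root
  \<open>s\<close> in the support of d pairs positively with d, hence positively with \<gamma> or
  negatively with \<mu>. By \<open>root_diff\<close>, either \<gamma> can be lowered by
  \<open>s\<close> or \<mu> raised by \<open>s\<close>.\<close>

lemma root_order_if_sum:
  assumes "\<mu> \<in> Pos" "\<gamma> \<in> Pos" "\<gamma> = \<mu> + (\<Sum>s\<in>S. real (c s) *\<^sub>R s)"
  shows "(\<mu>, \<gamma>) \<in> root_order \<Delta> S"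
  using assms
proof (induction "sum c S" arbitrary: c \<mu> \<gamma> rule: less_induct)
  case less
  let ?d = "\<Sum>s\<in>S. real (c s) *\<^sub>R s"
  show ?case
  proof (cases "?d = 0")
    case True
    then show ?thesis using less.prems by (simp add: root_order_def)
  next
    case False
    \<comment> \<open>The sum is the squared norm of \<open>?d\<close>; a positive term forces both
      its coefficient and its pairing to be positive.\<close>
    then have "(\<Sum>s\<in>S. real (c s) * (s \<bullet> ?d)) > 0"
      using inner_gt_zero_iff[of ?d] by (metis (mono_tags, lifting) inner_scaleR_left inner_sum_left sum.cong)
    then obtain s where s: "s \<in> S" "real (c s) * (s \<bullet> ?d) > 0"
      by (metis (no_types, lifting) linorder_not_less sum_nonpos)
    then have "c s > 0" "s \<bullet> ?d > 0"
      by (auto simp: zero_less_mult_iff)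
    then have "\<gamma> \<bullet> s > 0 \<or> (- \<mu>) \<bullet> s > 0"
      using less.prems(3) by (auto simp: inner_add_right inner_commute algebra_simps)
    define c' where "c' = c(s := c s - 1)"
    have remove: "?d = s + (\<Sum>s\<in>S. real (c' s) *\<^sub>R s)"
    proof -
      have "?d = real (c s) *\<^sub>R s + (\<Sum>t\<in>S-{s}. real (c t) *\<^sub>R t)"
        using s finite_S by (simp add: sum.remove)
      moreover have "(\<Sum>t\<in>S. real (c' t) *\<^sub>R t) = real (c s - 1) *\<^sub>R s + (\<Sum>t\<in>S-{s}. real (c t) *\<^sub>R t)"
        using s finite_S by (simp add: sum.remove c'_def)
      ultimately show ?thesis
        using \<open>c s > 0\<close> by (simp add: of_nat_diff algebra_simps)
    qed
    have "sum c S = c s + sum c (S - {s})" "sum c' S = (c s - 1) + sum c (S - {s})"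
      using s finite_S by (simp_all add: sum.remove c'_def)
    then have smaller: "sum c' S < sum c S"
      using \<open>c s > 0\<close> by simp
    have "?d \<in> root_cone"
      by (auto simp: root_cone_def)
    then have "height ?d \<ge> 1"
      using False height_cone_pos by blast
    \<comment> \<open>The heights exclude \<gamma> = s and -\<mu> = s, the degenerate cases of
      \<open>root_diff\<close>, and keep the new roots positive.\<close>
    then have hts: "height \<gamma> \<ge> height \<mu> + 1" "height \<mu> \<ge> 1" "height s = 1"
      using less.prems height_Pos height_simple s by (auto simp: height_linear_simps)
    have roots: "\<gamma> \<in> \<Delta>" "\<mu> \<in> \<Delta>" "s \<in> \<Delta>" "- \<mu> \<in> \<Delta>"
      using less.prems s S_subset Pos_subset by (auto simp: uminus_root_iff)
    show ?thesis
      using \<open>\<gamma> \<bullet> s > 0 \<or> (- \<mu>) \<bullet> s > 0\<close>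
    proof
      assume "\<gamma> \<bullet> s > 0"
      moreover have "\<gamma> \<noteq> s"
        using hts by auto
      ultimately have root: "\<gamma> - s \<in> \<Delta>"
        using root_diff[OF root_system] roots by blast
      have "\<gamma> - s \<in> Pos"
        using hts root by (simp add: Pos_iff_height height_linear_simps)
      then have "(\<mu>, \<gamma> - s) \<in> root_order \<Delta> S"
        using less.hyps[OF smaller less.prems(1)] less.prems(3) remove by simp
      moreover have "(\<gamma> - s, \<gamma>) \<in> root_order \<Delta> S"
        using root_order_step[OF \<open>\<gamma> - s \<in> Pos\<close> s(1)] roots by simp
      ultimately show ?thesis
        by (rule root_order_trans)
    next
      assume "(- \<mu>) \<bullet> s > 0"
      moreover have "- \<mu> \<noteq> s"
        using hts by (auto simp: height_linear_simps)
      ultimately have "- \<mu> - s \<in> \<Delta>"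
        using root_diff[OF root_system] roots by blast
      then have root: "\<mu> + s \<in> \<Delta>"
        using uminus_root_iff[of "\<mu> + s"] by simp
      have "\<mu> + s \<in> Pos"
        using hts root by (simp add: Pos_iff_height height_linear_simps)
      then have "(\<mu> + s, \<gamma>) \<in> root_order \<Delta> S"
        using less.hyps[OF smaller _ less.prems(2)] less.prems(3) remove by (simp add: add.assoc)
      then show ?thesis
        using root_order_step[OF less.prems(1) s(1) root] root_order_trans by blast
    qed
  qed
qed

lemma root_order_add:
  assumes "\<mu> \<in> Pos" "\<nu> \<in> Pos" "\<mu> + \<nu> \<in> \<Delta>"
  shows "(\<mu>, \<mu> + \<nu>) \<in> root_order \<Delta> S"
proof -
  have "\<mu> + \<nu> \<in> Pos"
    using assms root_cone_add by (simp add: Pos_iff_cone)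
  moreover obtain c :: "'a \<Rightarrow> nat" where "\<nu> = (\<Sum>s\<in>S. real (c s) *\<^sub>R s)"
    using assms(2) by (auto simp: pos_roots_def)
  ultimately show ?thesis
    using root_order_if_sum[OF assms(1)] by blast
qed

section \<open>The highest root\<close>

lemma theta_Pos: "\<theta> \<in> Pos"
  and theta_max: "\<mu> \<in> Pos \<Longrightarrow> (\<mu>, \<theta>) \<in> root_order \<Delta> S"
  using highest by (auto simp: highest_root_def)

text \<open>For negative \<mu> this says that \<theta> dominates -\<mu>. It serves to place \<delta>
  + \<mu> = (\<delta> - \<theta>) + (\<theta> + \<mu>) in the cone of the affine simple
  roots.\<close>

lemma theta_plus_root_cone:
  assumes "\<mu> \<in> \<Delta>"
  shows "\<theta> + \<mu> \<in> root_cone"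
proof (cases "\<mu> \<in> Pos")
  case True
  then show ?thesis
    using theta_Pos root_cone_add by (simp add: Pos_iff_cone)
next
  case False
  then show ?thesis
    using assms pos_or_neg root_order_diff_cone[OF theta_max, of "- \<mu>"] by auto
qed

lemma height_theta_ge: "\<mu> \<in> \<Delta> \<Longrightarrow> height \<theta> + height \<mu> \<ge> 0"
  using height_cone[OF theta_plus_root_cone, of \<mu>] by (auto simp: Nats_altdef2 height_linear_simps)

end

section \<open>Affine roots\<close>

lemma affine_form_commute: "affine_form x y = affine_form y x"
  by (simp add: affine_form_def split_beta inner_commute algebra_simps)

lemma affine_form_add_left: "affine_form (x + y) z = affine_form x z + affine_form y z"
  by (simp add: affine_form_def split_beta inner_add_left algebra_simps)

lemma affine_form_scaleR_left: "affine_form (c *\<^sub>R x) y = c * affine_form x y"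
  by (simp add: affine_form_def split_beta algebra_simps)

lemma affine_form_diff_left: "affine_form (x - y) z = affine_form x z - affine_form y z"
  by (simp add: affine_form_def split_beta inner_diff_left algebra_simps)

lemma affine_form_diff_right: "affine_form z (x - y) = affine_form z x - affine_form z y"
  by (simp add: affine_form_commute[of z] affine_form_diff_left)

lemma affine_form_scaleR_right: "affine_form y (c *\<^sub>R x) = c * affine_form y x"
  by (simp add: affine_form_commute[of y] affine_form_scaleR_left)

lemma reflect_eq: "reflect a x = x - (2 * affine_form x a / affine_form a a) *\<^sub>R a"
  by (simp add: reflect_def coroot_def affine_form_scaleR_right)

lemma linear_reflect: "linear (reflect a)"
  by (rule linearI)
    (simp_all add: reflect_eq affine_form_add_left affine_form_scaleR_left algebra_simps
      add_divide_distrib)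

lemma reflect_self: "affine_form a a \<noteq> 0 \<Longrightarrow> reflect a a = - a"
  by (simp add: reflect_eq scaleR_2)

lemma affine_form_reflect:
  "affine_form (reflect a x) y = affine_form x (reflect a y)"
  by (simp add: reflect_eq affine_form_diff_left affine_form_diff_right affine_form_scaleR_left
      affine_form_scaleR_right affine_form_commute[of y a])

text \<open>Conjugating a reflection by the involutive isometry \<open>reflect a\<close> gives the
  reflection in the image root. The exchange argument uses this to move a reflection past a
  letter.\<close>

lemma reflect_reflect_commute:
  assumes "affine_form a a \<noteq> 0"
  shows "reflect a (reflect (reflect a b) x) = reflect b (reflect a x)"
proof -
  have "affine_form (reflect a b) (reflect a b) = affine_form b b"
    using assms by (simp add: affine_form_reflect reflect_involution)
  moreover have "affine_form x (reflect a b) = affine_form (reflect a x) b"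
    by (simp add: affine_form_reflect)
  ultimately show ?thesis
    using assms
    by (simp add: reflect_eq[of "reflect a b"] reflect_eq[of b] linear_diff[OF linear_reflect]
        linear_cmul[OF linear_reflect] reflect_involution)
qed

context affine_root_datum
begin

text \<open>Only the real affine roots \<mu> + k\<delta>, with \<lambda>-coordinate 0. The imaginary
  roots k\<delta> are treated separately where they arise.\<close>

definition aroots :: "'a affine_space set" where
  "aroots = {(\<mu>, of_int k, 0) | \<mu> k. \<mu> \<in> \<Delta>}"

abbreviation apos :: "'a affine_space set" where "apos \<equiv> affine_pos_roots \<Delta> S"

abbreviation asimple :: "nat \<Rightarrow> 'a affine_space" where "asimple \<equiv> affine_simple \<alpha> \<theta>"

text \<open>The affine height: the value at \<delta> is forced by requiring the value 1 at the
  affine simple root \<delta> - \<theta>.\<close>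

definition aheight :: "'a affine_space \<Rightarrow> real" where
  "aheight x = height (fst x) + fst (snd x) * (1 + height \<theta>)"

lemma aheight_add: "aheight (x + y) = aheight x + aheight y"
  and aheight_diff: "aheight (x - y) = aheight x - aheight y"
  and aheight_uminus: "aheight (- x) = - aheight x"
  and aheight_delta: "aheight delta = 1 + height \<theta>"
  and aheight_scaleR: "aheight (c *\<^sub>R x) = c * aheight x"
  by (simp_all add: aheight_def height_linear_simps delta_def algebra_simps)

lemma height_theta: "height \<theta> \<ge> 1"
  using height_Pos theta_Pos by blast

lemma theta_root: "\<theta> \<in> \<Delta>"
  using theta_Pos Pos_subset by blast

text \<open>No root has height below \<open>- height \<theta>\<close>, whereas each \<delta>
  contributes \<open>1 + height \<theta>\<close>.\<close>

lemma aheight_pos: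
  assumes "\<mu> \<in> \<Delta>" "k \<ge> 1"
  shows "aheight (\<mu>, of_int k, b) > 0"
proof -
  have "of_int k * (1 + height \<theta>) \<ge> 1 * (1 + height \<theta>)"
    using assms height_theta by (intro mult_right_mono) auto
  then show ?thesis
    using height_theta_ge[OF assms(1)] by (simp add: aheight_def)
qed

lemma aheight_neg:
  assumes "\<mu> \<in> \<Delta>" "k \<le> -1"
  shows "aheight (\<mu>, of_int k, b) < 0"
proof -
  have "aheight (- \<mu>, of_int (- k), b) > 0"
    using assms by (intro aheight_pos) (auto simp: uminus_root_iff)
  then show ?thesis
    by (simp add: aheight_def height_linear_simps)
qed

lemma aheight_zero: "aheight (\<mu>, 0, b) = height \<mu>"
  by (simp add: aheight_def)

lemma aroots_cases:
  assumes "x \<in> aroots"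
  obtains \<mu> k where "\<mu> \<in> \<Delta>" "x = (\<mu>, of_int k, 0)"
  using assms unfolding aroots_def by blast

lemma aroots_intro: "\<mu> \<in> \<Delta> \<Longrightarrow> (\<mu>, of_int k, 0) \<in> aroots"
  unfolding aroots_def by blast

lemma apos_cases:
  assumes "x \<in> apos"
  obtains \<mu> where "\<mu> \<in> Pos" "x = embed \<mu>"
  | \<mu> k where "\<mu> \<in> \<Delta>" "k \<ge> 1" "x = embed \<mu> + real k *\<^sub>R delta"
  using assms unfolding affine_pos_roots_def by blast

text \<open>Level 0 is the finite case, and otherwise the sign of the level decides the sign of the
  height. Positivity thus becomes the sign of a linear functional.\<close>

lemma apos_iff: "x \<in> apos \<longleftrightarrow> x \<in> aroots \<and> aheight x > 0"
proof
  assume "x \<in> apos"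
  then show "x \<in> aroots \<and> aheight x > 0"
  proof (cases rule: apos_cases)
    case (1 \<mu>)
    then show ?thesis
      using Pos_subset height_Pos[of \<mu>] aroots_intro[of \<mu> 0]
      by (auto simp: embed_def aheight_zero)
  next
    case (2 \<mu> k)
    then have "x = (\<mu>, of_int (int k), 0)"
      by (simp add: embed_def delta_def)
    then show ?thesis
      using 2 aheight_pos[of \<mu> "int k"] aroots_intro[of \<mu> "int k"] by simp
  qed
next
  assume "x \<in> aroots \<and> aheight x > 0"
  then obtain \<mu> k where x: "\<mu> \<in> \<Delta>" "x = (\<mu>, of_int k, 0)" "aheight x > 0"
    using aroots_cases by blast
  have "\<not> k \<le> -1"
    using x aheight_neg[of \<mu> k 0] by auto
  show "x \<in> apos"
  proof (cases "k = 0")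
    case True
    then have "\<mu> \<in> Pos" "x = embed \<mu>"
      using x by (auto simp: Pos_iff_height embed_def aheight_zero)
    then show ?thesis
      by (simp add: affine_pos_roots_def)
  next
    case False
    then have "nat k \<ge> 1" "x = embed \<mu> + real (nat k) *\<^sub>R delta"
      using x \<open>\<not> k \<le> -1\<close> by (auto simp: embed_def delta_def)
    then show ?thesis
      using x unfolding affine_pos_roots_def by blast
  qed
qed

lemma uminus_aroots: "x \<in> aroots \<Longrightarrow> - x \<in> aroots"
proof -
  assume "x \<in> aroots"
  then obtain \<mu> k where "\<mu> \<in> \<Delta>" "x = (\<mu>, of_int k, 0)"
    unfolding aroots_def by auto
  then have "- \<mu> \<in> \<Delta>" "- x = (- \<mu>, of_int (- k), 0)"
    by (auto simp: uminus_root_iff)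
  then show ?thesis
    unfolding aroots_def by blast
qed

lemma aheight_Ints:
  assumes "x \<in> aroots"
  shows "aheight x \<in> \<int>"
  using assms height_root_Ints theta_root unfolding aroots_def aheight_def
  by (auto intro!: Ints_add Ints_mult)

lemma aheight_neq_0:
  assumes "x \<in> aroots"
  shows "aheight x \<noteq> 0"
proof -
  obtain \<mu> k where x: "\<mu> \<in> \<Delta>" "x = (\<mu>, of_int k, 0)"
    using assms unfolding aroots_def by auto
  consider "k = 0" | "k \<ge> 1" | "k \<le> -1"
    by linarith
  then show ?thesis
  proof cases
    case 1
    then show ?thesis using x height_root_neq_0 by (simp add: aheight_zero)
  next
    case 2
    then show ?thesis using x aheight_pos[of \<mu> k 0] by simp
  next
    case 3
    then show ?thesis using x aheight_neg[of \<mu> k 0] by simp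
  qed
qed

lemma apos_or_neg: "x \<in> aroots \<Longrightarrow> x \<in> apos \<or> - x \<in> apos"
  using aheight_neq_0[of x] uminus_aroots[of x] by (auto simp: apos_iff aheight_uminus)

lemma not_apos_neg: "x \<in> apos \<Longrightarrow> - x \<notin> apos"
  by (simp add: apos_iff aheight_uminus)

lemma aheight_apos: "x \<in> apos \<Longrightarrow> aheight x \<ge> 1"
  using aheight_Ints[of x] by (auto simp: apos_iff elim!: Ints_cases)

lemma asimple_aroots: "i \<le> n \<Longrightarrow> asimple i \<in> aroots"
  and aheight_asimple: "i \<le> n \<Longrightarrow> aheight (asimple i) = 1"
proof -
  assume "i \<le> n"
  have "- \<theta> \<in> \<Delta>"
    using theta_root by (simp add: uminus_root_iff)
  moreover have "\<alpha> i \<in> S" if "i \<noteq> 0"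
    using that \<open>i \<le> n\<close> by (auto simp: S_eq)
  moreover have "asimple i = (if i = 0 then (- \<theta>, of_int 1, 0) else (\<alpha> i, of_int 0, 0))"
    by (auto simp: affine_simple_def delta_def embed_def)
  ultimately show "asimple i \<in> aroots" "aheight (asimple i) = 1"
    using S_subset height_simple unfolding aroots_def
    by (auto split: if_splits simp: aheight_def height_linear_simps)
qed

lemma asimple_apos: "i \<le> n \<Longrightarrow> asimple i \<in> apos"
  by (simp add: apos_iff asimple_aroots aheight_asimple)

lemma affine_form_aroots: "x \<in> aroots \<Longrightarrow> affine_form x x > 0"
  using zero_notin_roots by (auto simp: aroots_def affine_form_def)

section \<open>Nonnegative combinations of the affine simple roots\<close>

definition acone :: "'a affine_space set" where
  "acone = range (\<lambda>c::nat \<Rightarrow> nat. \<Sum>i\<le>n. real (c i) *\<^sub>R asimple i)"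

lemma acone_add:
  assumes "x \<in> acone" "y \<in> acone"
  shows "x + y \<in> acone"
proof -
  obtain c d :: "nat \<Rightarrow> nat"
    where "x = (\<Sum>i\<le>n. real (c i) *\<^sub>R asimple i)" "y = (\<Sum>i\<le>n. real (d i) *\<^sub>R asimple i)"
    using assms unfolding acone_def by auto
  then have "x + y = (\<Sum>i\<le>n. real (c i + d i) *\<^sub>R asimple i)"
    by (simp add: sum.distrib scaleR_add_left)
  then show ?thesis
    unfolding acone_def by (rule range_eqI[of _ _ "\<lambda>i. c i + d i"])
qed

lemma atMost_insert_0: "{..n} = insert 0 {1..n}"
  by auto

lemma embed_root_cone:
  assumes "x \<in> root_cone"
  shows "embed x \<in> acone"
proof -
  obtain c :: "'a \<Rightarrow> nat" where "x = (\<Sum>s\<in>S. real (c s) *\<^sub>R s)"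
    using assms unfolding root_cone_def by auto
  then have x: "x = (\<Sum>i=1..n. real (c (\<alpha> i)) *\<^sub>R \<alpha> i)"
    unfolding S_eq by (subst (asm) sum.reindex[OF inj]) (simp only: o_def)
  have "linear (embed :: 'a \<Rightarrow> _)"
    by (rule linearI) (auto simp: embed_def)
  then have "embed x = (\<Sum>i=1..n. real (c (\<alpha> i)) *\<^sub>R embed (\<alpha> i))"
    by (simp add: x linear_sum linear_cmul)
  also have "\<dots> = (\<Sum>i\<le>n. real (if i = 0 then 0 else c (\<alpha> i)) *\<^sub>R asimple i)"
    unfolding atMost_insert_0 by (simp add: affine_simple_def)
  finally show ?thesis
    unfolding acone_def by (rule range_eqI[of _ _ "\<lambda>i. if i = 0 then 0 else c (\<alpha> i)"])
qed

lemma asimple_0_in_acone: "asimple 0 \<in> acone"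
proof -
  have "asimple 0 = (\<Sum>i\<le>n. real (if i = 0 then 1 else 0) *\<^sub>R asimple i)"
    unfolding atMost_insert_0 by simp
  then show ?thesis
    unfolding acone_def by (rule range_eqI[of _ _ "\<lambda>i. if i = 0 then 1 else 0"])
qed

lemma delta_multiple_acone: "real k *\<^sub>R delta \<in> acone"
proof (induction k)
  case 0
  have "embed 0 = (real 0 *\<^sub>R delta :: 'a affine_space)"
    by (simp add: embed_def zero_prod_def)
  then show ?case
    using embed_root_cone[OF zero_in_root_cone] by metis
next
  case (Suc k)
  have "real (Suc k) *\<^sub>R delta = real k *\<^sub>R delta + (asimple 0 + embed \<theta>)"
    by (simp add: affine_simple_def algebra_simps)
  then show ?case
    using Suc acone_add asimple_0_in_acone embed_root_cone theta_Pos by (metis Pos_iff_cone)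
qed

lemma apos_acone:
  assumes "x \<in> apos"
  shows "x \<in> acone"
proof -
  show ?thesis
    using assms
  proof (cases rule: apos_cases)
    case (1 \<mu>)
    then show ?thesis by (simp add: embed_root_cone Pos_iff_cone)
  next
    case (2 \<mu> k)
    \<comment> \<open>One \<delta> is spent on the affine simple root \<delta> - \<theta>; the
      compensating \<theta> makes \<open>\<theta> + \<mu>\<close> a nonnegative combination even
      when \<mu> is negative.\<close>
    then have "x = embed (\<theta> + \<mu>) + (asimple 0 + real (k - 1) *\<^sub>R delta)"
      by (simp add: affine_simple_def embed_def delta_def of_nat_diff)
    then show ?thesis
      using 2 acone_add asimple_0_in_acone embed_root_cone theta_plus_root_cone delta_multiple_acone
      by metis
  qed
qed

text \<open>The \<delta>-coordinate sees only \<open>asimple 0\<close> and kills its coefficient;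
  what remains is a relation among the independent finite simple roots.\<close>

lemma asimple_independent:
  assumes "(\<Sum>i\<le>n. c i *\<^sub>R asimple i) = 0" "i \<le> n"
  shows "c i = 0"
proof -
  have sum0: "c 0 *\<^sub>R asimple 0 + (\<Sum>i=1..n. c i *\<^sub>R asimple i) = 0"
    using assms(1) unfolding atMost_insert_0 by simp
  have tail: "(\<Sum>i=1..n. c i *\<^sub>R asimple i) = (\<Sum>i=1..n. c i *\<^sub>R embed (\<alpha> i))"
    by (rule sum.cong) (auto simp: affine_simple_def)
  have "fst (snd (\<Sum>i=1..n. c i *\<^sub>R embed (\<alpha> i))) = 0"
    by (simp add: snd_sum fst_sum embed_def)
  with arg_cong[OF sum0, of "\<lambda>x. fst (snd x)"] have c0: "c 0 = 0"
    by (simp add: tail affine_simple_def delta_def embed_def)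
  then have "fst (\<Sum>i=1..n. c i *\<^sub>R embed (\<alpha> i)) = 0"
    using sum0 tail by simp
  then have "(\<Sum>i=1..n. c i *\<^sub>R \<alpha> i) = 0"
    by (simp add: fst_sum embed_def)
  define g where "g = the_inv_into {1..n} \<alpha>"
  have g: "g (\<alpha> i) = i" if "i \<in> {1..n}" for i
    unfolding g_def using inj that by (rule the_inv_into_f_f)
  have "(\<Sum>s\<in>S. c (g s) *\<^sub>R s) = (\<Sum>i=1..n. c (g (\<alpha> i)) *\<^sub>R \<alpha> i)"
    unfolding S_eq by (subst sum.reindex[OF inj]) (simp only: o_def)
  also have "\<dots> = (\<Sum>i=1..n. c i *\<^sub>R \<alpha> i)"
    by (rule sum.cong) (simp_all add: g)
  also have "\<dots> = 0"
    by fact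
  finally have zero: "c (g s) = 0" if "s \<in> S" for s
    using independentD[OF independent_S finite_S subset_refl _ that, of "\<lambda>s. c (g s)"] by blast
  show ?thesis
  proof (cases "i = 0")
    case False
    then have "i \<in> {1..n}"
      using assms(2) by simp
    then show ?thesis
      using zero[of "\<alpha> i"] g by (simp add: S_eq)
  qed (simp add: c0)
qed

lemma inj_asimple: "inj_on asimple {0..n}"
proof (rule inj_onI)
  fix i j
  assume ij: "i \<in> {0..n}" "j \<in> {0..n}" "asimple i = asimple j"
  have lev: "fst (snd (asimple i)) = (if i = 0 then 1 else 0)" for i
    by (simp add: affine_simple_def delta_def embed_def)
  have "i = 0 \<longleftrightarrow> j = 0"
    using ij lev by (metis zero_neq_one)
  show "i = j"
  proof (cases "i = 0")
    case False
    then have "\<alpha> i = \<alpha> j" "i \<in> {1..n}" "j \<in> {1..n}"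
      using ij \<open>i = 0 \<longleftrightarrow> j = 0\<close> by (auto simp: affine_simple_def embed_def)
    then show ?thesis
      by (rule inj_onD[OF inj])
  qed (use \<open>i = 0 \<longleftrightarrow> j = 0\<close> in simp)
qed

text \<open>The squared norm of the finite part of \<open>x\<close> is positive; when one factor is
  expanded in affine simple roots, some term must be positive.\<close>

lemma apos_pairing:
  assumes "x \<in> apos"
  obtains i where "i \<le> n" "fst x \<bullet> fst (asimple i) > 0"
proof -
  obtain c :: "nat \<Rightarrow> nat" where c: "x = (\<Sum>i\<le>n. real (c i) *\<^sub>R asimple i)"
    using apos_acone[OF assms] unfolding acone_def by auto
  have "fst x \<bullet> fst x > 0"
    using assms zero_notin_roots by (auto simp: apos_iff aroots_def)
  moreover have "fst x \<bullet> fst x = (\<Sum>i\<le>n. real (c i) * (fst x \<bullet> fst (asimple i)))"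
    by (subst (2) c) (simp add: fst_sum inner_sum_right)
  ultimately obtain i where "i \<le> n" "real (c i) * (fst x \<bullet> fst (asimple i)) > 0"
    by (metis (no_types, lifting) atMost_iff linorder_not_less sum_nonpos)
  then show thesis
    using that by (auto simp: zero_less_mult_iff)
qed

text \<open>Subtract a simple root that pairs positively with \<open>x\<close>. If the finite parts
  differ, \<open>root_diff\<close> makes the difference a real root, positive because its height is
  nonnegative and not 0. If they agree, the difference is a nonnegative multiple of
  \<delta>.\<close>

lemma apos_decompose:
  assumes "x \<in> apos"
  obtains i where "i \<le> n" "x = asimple i"
  | i where "i \<le> n" "x - asimple i \<in> apos"
  | i k where "i \<le> n" "(k::int) \<ge> 1" "x - asimple i = of_int k *\<^sub>R delta"
proof -
  obtain i where i: "i \<le> n" "fst x \<bullet> fst (asimple i) > 0"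
    using apos_pairing[OF assms] .
  obtain \<mu> k where x: "x = (\<mu>, of_int k, 0)" "\<mu> \<in> \<Delta>"
    using assms by (auto simp: apos_iff aroots_def)
  obtain \<nu> l where a: "asimple i = (\<nu>, of_int l, 0)" "\<nu> \<in> \<Delta>"
    using asimple_aroots[OF i(1)] by (auto simp: aroots_def)
  have diff: "x - asimple i = (\<mu> - \<nu>, of_int (k - l), 0)"
    by (simp add: x a)
  have ht: "aheight (x - asimple i) \<ge> 0"
    using aheight_apos[OF assms] aheight_asimple[OF i(1)] by (simp add: aheight_diff)
  show thesis
  proof (cases "\<mu> = \<nu>")
    case True
    then have eq: "x - asimple i = of_int (k - l) *\<^sub>R delta"
      by (simp add: diff delta_def)
    then have "k - l \<ge> 0"
      using ht height_theta by (simp add: aheight_scaleR aheight_delta zero_le_mult_iff)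
    then consider "k - l = 0" | "k - l \<ge> 1"
      by linarith
    then show thesis
      using eq that(1)[OF i(1)] that(3)[OF i(1)] by cases auto
  next
    case False
    then have "\<mu> - \<nu> \<in> \<Delta>"
      using root_diff[OF root_system] i x a by simp
    then have "x - asimple i \<in> aroots"
      unfolding aroots_def diff by blast
    then have "x - asimple i \<in> apos"
      using ht aheight_neq_0 by (fastforce simp: apos_iff)
    then show thesis
      using that(2) i by blast
  qed
qed

text \<open>Heights add and simple roots have height 1. The formulation by heights also covers the
  summand \<delta>, which is not in \<open>apos\<close>.\<close>

lemma asimple_indecomposable:
  assumes "i \<le> n" "aheight x \<ge> 1" "aheight y \<ge> 1"
  shows "x + y \<noteq> asimple i"
  using assms aheight_asimple[of i] by (auto simp: aheight_add dest!: arg_cong[of _ _ aheight])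

section \<open>The affine Weyl group\<close>

abbreviation W :: "('a affine_space \<Rightarrow> 'a affine_space) set" where "W \<equiv> affine_weyl n \<alpha> \<theta>"

abbreviation srefl :: "nat \<Rightarrow> 'a affine_space \<Rightarrow> 'a affine_space" where
  "srefl i \<equiv> reflect (asimple i)"

abbreviation N :: "('a affine_space \<Rightarrow> 'a affine_space) \<Rightarrow> 'a affine_space set" where
  "N \<equiv> inversions \<Delta> S"

lemma reflect_aroots:
  assumes "a \<in> aroots" "x \<in> aroots"
  shows "reflect a x \<in> aroots"
proof -
  obtain \<nu> l where a: "\<nu> \<in> \<Delta>" "a = (\<nu>, of_int l, 0)"
    using assms(1) by (rule aroots_cases)
  obtain \<mu> k where x: "\<mu> \<in> \<Delta>" "x = (\<mu>, of_int k, 0)"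
    using assms(2) by (rule aroots_cases)
  have "2 * (\<mu> \<bullet> \<nu>) / (\<nu> \<bullet> \<nu>) \<in> \<int>"
    and refl: "\<mu> - (2 * (\<mu> \<bullet> \<nu>) / (\<nu> \<bullet> \<nu>)) *\<^sub>R \<nu> \<in> \<Delta>"
    using a(1) x(1) root_system unfolding root_system_def by blast+
  then obtain m where m: "2 * (\<mu> \<bullet> \<nu>) / (\<nu> \<bullet> \<nu>) = of_int m"
    by (elim Ints_cases)
  then have "reflect a x = (\<mu> - of_int m *\<^sub>R \<nu>, of_int (k - m * l), 0)"
    by (simp add: reflect_eq affine_form_def a(2) x(2))
  then show ?thesis
    using refl aroots_intro by (simp only: m)
qed

lemma reflect_aroots_iff:
  assumes "a \<in> aroots"
  shows "reflect a x \<in> aroots \<longleftrightarrow> x \<in> aroots"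
proof -
  have "affine_form a a \<noteq> 0"
    using affine_form_aroots[OF assms] by simp
  then show ?thesis
    using reflect_aroots[OF assms] reflect_involution by metis
qed

lemma reflect_delta:
  assumes "a \<in> aroots"
  shows "reflect a delta = delta"
  using assms by (elim aroots_cases) (simp add: reflect_eq affine_form_def delta_def)

lemma srefl_refl: "i \<le> n \<Longrightarrow> srefl i (srefl i x) = x"
  using affine_form_aroots[OF asimple_aroots] by (intro reflect_involution) force

lemma srefl_asimple: "i \<le> n \<Longrightarrow> srefl i (asimple i) = - asimple i"
  using affine_form_aroots[OF asimple_aroots] by (intro reflect_self) force

lemma bij_srefl: "i \<le> n \<Longrightarrow> bij (srefl i)"
  by (rule o_bij[of "srefl i"]) (auto simp: srefl_refl)

lemma inv_srefl: "i \<le> n \<Longrightarrow> inv (srefl i) = srefl i"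
  by (rule inv_equality) (auto simp: srefl_refl)

text \<open>If \<open>x\<close> and \<open>- srefl i x\<close> were both positive, then, their sum
  being a multiple of \<open>asimple i\<close>, independence would make \<open>x\<close> itself such
  a multiple; reducedness leaves only \<open>asimple i\<close>.\<close>

lemma srefl_apos:
  assumes "i \<le> n" "x \<in> apos" "x \<noteq> asimple i"
  shows "srefl i x \<in> apos"
proof (rule ccontr)
  assume "srefl i x \<notin> apos"
  moreover have "srefl i x \<in> aroots"
    using assms asimple_aroots by (simp add: apos_iff reflect_aroots)
  ultimately have neg: "- srefl i x \<in> apos"
    using apos_or_neg by blast
  obtain c d :: "nat \<Rightarrow> nat" where c: "x = (\<Sum>j\<le>n. real (c j) *\<^sub>R asimple j)"
    and d: "- srefl i x = (\<Sum>j\<le>n. real (d j) *\<^sub>R asimple j)"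
    using apos_acone[OF assms(2)] apos_acone[OF neg] unfolding acone_def by blast
  define m where "m = 2 * affine_form x (asimple i) / affine_form (asimple i) (asimple i)"
  have "m *\<^sub>R asimple i = (\<Sum>j\<le>n. (if j = i then m else 0) *\<^sub>R asimple j)"
    using assms(1) by (simp add: if_distrib[of "\<lambda>r. r *\<^sub>R _"] cong: if_cong)
  moreover have "x + - srefl i x = m *\<^sub>R asimple i"
    by (simp add: reflect_eq m_def)
  ultimately have "(\<Sum>j\<le>n. real (c j) *\<^sub>R asimple j) + (\<Sum>j\<le>n. real (d j) *\<^sub>R asimple j) =
      (\<Sum>j\<le>n. (if j = i then m else 0) *\<^sub>R asimple j)"
    by (simp only: flip: c d)
  then have "(\<Sum>j\<le>n. (real (c j) + real (d j) - (if j = i then m else 0)) *\<^sub>R asimple j) = 0"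
    by (simp only: scaleR_add_left scaleR_diff_left sum.distrib sum_subtractf diff_self)
  then have "real (c j) + real (d j) - (if j = i then m else 0) = 0" if "j \<le> n" for j
    using asimple_independent[of "\<lambda>j. real (c j) + real (d j) - (if j = i then m else 0)"] that
    by simp
  then have c0: "c j = 0" if "j \<le> n" "j \<noteq> i" for j
    using that by force
  have "x = (\<Sum>j\<le>n. if j = i then real (c i) *\<^sub>R asimple i else 0)"
    unfolding c by (rule sum.cong) (auto simp: c0)
  then have x: "x = real (c i) *\<^sub>R asimple i"
    using assms(1) by simp
  \<comment> \<open>Reducedness speaks of finite roots, so it is applied to first components; the
    factor -1 drops out since \<open>c i\<close> is a natural number.\<close>
  have "fst (asimple i) \<in> \<Delta>" "fst x \<in> \<Delta>"
    using assms asimple_aroots[of i] by (auto simp: apos_iff elim!: aroots_cases)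
  then have "real (c i) = 1 \<or> real (c i) = -1"
    using reduced unfolding reduced_roots_def by (metis x fst_scaleR)
  then have "x = asimple i"
    using x by auto
  with assms show False
    by blast
qed

lemma W_srefl: "i \<le> n \<Longrightarrow> srefl i \<in> W"
  using affine_weyl.step[OF _ affine_weyl.one] by fastforce

lemma W_induct [consumes 1, case_names one step]:
  assumes "w \<in> W" "P id"
    and "\<And>i w. i \<le> n \<Longrightarrow> w \<in> W \<Longrightarrow> P w \<Longrightarrow> P (srefl i \<circ> w)"
  shows "P w"
  using assms(1) by induction (use assms(2,3) in \<open>simp_all add: id_def comp_def\<close>)

lemma W_linear: "w \<in> W \<Longrightarrow> linear w"
  and W_bij: "w \<in> W \<Longrightarrow> bij w"
  and W_delta: "w \<in> W \<Longrightarrow> w delta = delta"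
  and W_aroots: "w \<in> W \<Longrightarrow> w x \<in> aroots \<longleftrightarrow> x \<in> aroots"
proof -
  assume "w \<in> W"
  then have "linear w \<and> bij w \<and> w delta = delta \<and> (\<forall>x. w x \<in> aroots \<longleftrightarrow> x \<in> aroots)"
  proof (induction rule: W_induct)
    case one
    show ?case by (intro conjI linear_id bij_id) simp_all
  next
    case (step i w)
    have "linear (srefl i \<circ> w)" "bij (srefl i \<circ> w)"
      using step linear_compose linear_reflect bij_comp bij_srefl by blast+
    moreover have "(srefl i \<circ> w) delta = delta \<and> (\<forall>x. (srefl i \<circ> w) x \<in> aroots \<longleftrightarrow> x \<in> aroots)"
      using step asimple_aroots[of i] by (simp add: reflect_delta reflect_aroots_iff)
    ultimately show ?case by blast
  qed
  then show "linear w" "bij w" "w delta = delta" "w x \<in> aroots \<longleftrightarrow> x \<in> aroots"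
    by blast+
qed

lemma W_comp: "u \<in> W \<Longrightarrow> w \<in> W \<Longrightarrow> u \<circ> w \<in> W"
proof (induction rule: W_induct)
  case (step i u)
  then show ?case
    using affine_weyl.step[of i n "u \<circ> w"] by (simp only: comp_assoc)
qed simp

lemma W_inv: "w \<in> W \<Longrightarrow> inv w \<in> W"
proof (induction rule: W_induct)
  case one
  show ?case using affine_weyl.one by (simp only: inv_id)
next
  case (step i w)
  then show ?case
    using W_comp[OF step.IH W_srefl[OF step.hyps(1)]]
    by (simp only: o_inv_distrib[OF bij_srefl W_bij] inv_srefl)
qed

lemma W_inv_apply: "w \<in> W \<Longrightarrow> w (inv w x) = x" "w \<in> W \<Longrightarrow> inv w (w x) = x"
  using W_bij by (simp_all add: bij_is_surj surj_f_inv_f bij_is_inj)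

lemma W_inj: "w \<in> W \<Longrightarrow> w x = w y \<longleftrightarrow> x = y"
  using W_bij by (simp add: bij_is_inj inj_eq)

lemma W_inv_eq_iff: "w \<in> W \<Longrightarrow> inv w x = y \<longleftrightarrow> w y = x"
  using W_inv_apply by metis

lemmas W_add = linear_add[OF W_linear]
lemmas W_diff = linear_diff[OF W_linear]
lemmas W_uminus = linear_neg[OF W_linear]

section \<open>Inversion sets and words\<close>

lemma in_uminus_apos_iff: "x \<in> aroots \<Longrightarrow> x \<in> uminus ` apos \<longleftrightarrow> x \<notin> apos"
  using apos_or_neg not_apos_neg by (metis imageE image_eqI minus_minus)

lemma N_iff: "w \<in> W \<Longrightarrow> x \<in> N w \<longleftrightarrow> x \<in> apos \<and> w x \<notin> apos"
  using in_uminus_apos_iff[of "w x"] W_aroots[of w x] apos_iff[of x]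
  by (auto simp: inversions_def)

text \<open>The main way in which \<open>N w = D J\<close> enters later: a negative root with
  positive image must be \<gamma> - \<delta> for some \<gamma> \<in> J.\<close>

lemma N_negD:
  assumes "w \<in> W" "x \<in> aroots" "x \<notin> apos" "w x \<in> apos"
  shows "- x \<in> N w"
  using assms apos_or_neg[of x] not_apos_neg[of "w x"] by (simp add: N_iff W_uminus)

text \<open>Words need not be reduced; the least possible \<open>k\<close> is the length of the
  element.\<close>

primrec words :: "nat \<Rightarrow> ('a affine_space \<Rightarrow> 'a affine_space) set" where
  "words 0 = {id}"
| "words (Suc k) = {srefl i \<circ> w | i w. i \<le> n \<and> w \<in> words k}"

lemma words_W: "w \<in> words k \<Longrightarrow> w \<in> W"
  by (induction k arbitrary: w) (auto intro: affine_weyl.intros)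

lemma W_words: "w \<in> W \<Longrightarrow> \<exists>k. w \<in> words k"
proof (induction rule: W_induct)
  case one
  show ?case by (intro exI[of _ 0]) (simp only: words.simps singleton_iff)
next
  case (step i w)
  then obtain k where "w \<in> words k" by blast
  then have "srefl i \<circ> w \<in> words (Suc k)"
    using step.hyps(1) by auto
  then show ?case by blast
qed

text \<open>The exchange condition, by induction on the word. If \<open>x\<close> is the simple root
  of the first letter, the reflection cancels that letter. Otherwise the letter sends
  \<open>x\<close> to a positive root, the induction hypothesis applies to the rest of the word, and
  conjugation carries the result back.\<close>

lemma exchange:
  assumes "w \<in> words k" "x \<in> apos" "inv w x \<notin> apos"
  shows "k \<ge> 1 \<and> reflect x \<circ> w \<in> words (k - 1)"
  using assms
proof (induction k arbitrary: w x)
  case 0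
  then show ?case by simp
next
  case (Suc k)
  then obtain j w' where w: "w = srefl j \<circ> w'" "j \<le> n" "w' \<in> words k"
    by auto
  have "w' \<in> W"
    using w words_W by blast
  show ?case
  proof (cases "x = asimple j")
    case True
    then have "reflect x \<circ> w = w'"
      using w by (auto simp: srefl_refl)
    then show ?thesis
      using w(3) by (simp only: diff_Suc_1) simp
  next
    case False
    define y where "y = srefl j x"
    have "inv w x = inv w' y"
      using w \<open>w' \<in> W\<close> W_bij bij_srefl by (simp add: o_inv_distrib inv_srefl y_def)
    moreover have "y \<in> apos"
      using srefl_apos[OF w(2) Suc.prems(2) False] by (simp add: y_def)
    ultimately have IH: "k \<ge> 1" "reflect y \<circ> w' \<in> words (k - 1)"
      using Suc.IH[OF w(3), of y] Suc.prems(3) by metis+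
    have "affine_form (asimple j) (asimple j) \<noteq> 0"
      using affine_form_aroots[OF asimple_aroots[OF w(2)]] by simp
    then have "reflect x \<circ> w = srefl j \<circ> (reflect y \<circ> w')"
      by (auto simp: w y_def reflect_reflect_commute)
    also have "\<dots> \<in> words (Suc (k - 1))"
      unfolding words.simps using IH(2) w(2) by blast
    also have "Suc (k - 1) = k"
      using IH(1) by simp
    finally show ?thesis
      by (simp only: diff_Suc_1) simp
  qed
qed

text \<open>A nonempty shortest word \<open>srefl j \<circ> w'\<close> exhibits an inversion: the
  preimage of \<open>asimple j\<close> under \<open>w'\<close> is positive by minimality, and
  \<open>w\<close> sends it to \<open>- asimple j\<close>.\<close>

lemma N_empty_imp_id:
  assumes "w \<in> W" "N w = {}"
  shows "w = id"
proof -
  define k where "k = (LEAST k. w \<in> words k)"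
  have k: "w \<in> words k"
    using LeastI_ex[OF W_words[OF assms(1)]] by (simp add: k_def)
  have min: "k \<le> j" if "w \<in> words j" for j
    using that by (simp add: k_def Least_le)
  show ?thesis
  proof (cases k)
    case 0
    then show ?thesis using k by simp
  next
    case (Suc m)
    then obtain j w' where w: "w = srefl j \<circ> w'" "j \<le> n" "w' \<in> words m"
      using k by auto
    have "w' \<in> W"
      using w words_W by blast
    define x where "x = inv w' (asimple j)"
    have "x \<in> apos"
    proof (rule ccontr)
      assume "x \<notin> apos"
      \<comment> \<open>\<open>exchange\<close> is applied to \<open>w'\<close> and the reflection
        in \<open>asimple j\<close>, whose product is \<open>w\<close> itself; this would give
        \<open>w\<close> a word of length \<open>m - 1\<close>.\<close>
      then have "m \<ge> 1" "w \<in> words (m - 1)"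
        using exchange[OF w(3) asimple_apos[OF w(2)]] by (auto simp: x_def w(1))
      then show False
        using min[of "m - 1"] Suc by simp
    qed
    moreover have "w x = - asimple j"
      using w \<open>w' \<in> W\<close> by (simp add: x_def W_inv_apply srefl_asimple)
    ultimately have "x \<in> N w"
      using assms(1) not_apos_neg asimple_apos[OF w(2)] by (simp add: N_iff)
    then show ?thesis
      using assms(2) by simp
  qed
qed

text \<open>Equal inversion sets mean that \<open>u\<close> and \<open>w\<close> make the same roots
  positive, so \<open>u \<circ> inv w\<close> has no inversions. This yields uniqueness of minuscule
  elements.\<close>

lemma N_inject:
  assumes "u \<in> W" "w \<in> W" "N u = N w"
  shows "u = w"
proof -
  have W: "u \<circ> inv w \<in> W"
    using assms by (simp add: W_comp W_inv)
  have "(u \<circ> inv w) x \<in> apos" if x: "x \<in> apos" for x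
  proof -
    define y where "y = inv w x"
    have wy: "w y = x"
      using assms by (simp add: y_def W_inv_apply)
    then have y: "y \<in> aroots"
      using x W_aroots[OF assms(2), of y] by (simp add: apos_iff)
    have "u y \<in> apos"
    proof (cases "y \<in> apos")
      case True
      then show ?thesis
        using wy x assms N_iff by metis
    next
      case False
      then have "- y \<in> N u"
        using N_negD[OF assms(2) y] wy x assms(3) by simp
      then have "u (- y) \<notin> apos" "u (- y) \<in> aroots"
        using assms(1) y uminus_aroots by (auto simp: N_iff W_aroots)
      then have "- u (- y) \<in> apos"
        using apos_or_neg by blast
      then show ?thesis
        using assms(1) by (simp add: W_uminus)
    qed
    then show ?thesis
      by (simp add: y_def)
  qed
  then have "N (u \<circ> inv w) = {}"
    using N_iff[OF W] by blast
  then have "u \<circ> inv w = id"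
    using N_empty_imp_id W by blast
  then have "u (inv w (w x)) = w x" for x
    by (metis comp_apply id_apply)
  then show ?thesis
    using assms by (auto simp: W_inv_apply)
qed

text \<open>Among real roots, \<open>srefl i\<close> changes the sign of \<open>asimple i\<close>
  and its negative only, and \<open>x\<close> is the only positive root that \<open>w\<close> sends
  to one of these two.\<close>

lemma N_step:
  assumes "w \<in> W" "i \<le> n" "x \<in> apos" "w x = asimple i"
  shows "N (srefl i \<circ> w) = insert x (N w)"
proof -
  have W: "srefl i \<circ> w \<in> W"
    using assms by (simp add: affine_weyl.step)
  have "y \<in> N (srefl i \<circ> w) \<longleftrightarrow> y \<in> insert x (N w)" if y: "y \<in> apos" for y
  proof (cases "y = x")
    case True
    then show ?thesis
      using assms W not_apos_neg[OF asimple_apos] by (simp add: N_iff srefl_asimple)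
  next
    case False
    show ?thesis
    proof (cases "w y \<in> apos")
      case True
      moreover have "w y \<noteq> asimple i"
        using False assms W_inj by metis
      ultimately show ?thesis
        using srefl_apos[OF assms(2)] y False W assms(1) by (simp add: N_iff)
    next
      case 2: False
      have "w y \<in> aroots"
        using y assms(1) by (simp add: W_aroots apos_iff)
      then have neg: "- w y \<in> apos"
        using 2 apos_or_neg by blast
      have "- w y \<noteq> asimple i"
        using assms W_inj[OF assms(1), of "- y" x] not_apos_neg[OF y] by (auto simp: W_uminus)
      then have "srefl i (- w y) \<in> apos"
        using neg srefl_apos[OF assms(2)] by blast
      then have "srefl i (w y) \<notin> apos"
        using not_apos_neg by (fastforce simp: linear_neg[OF linear_reflect])
      then show ?thesis
        using y 2 W assms(1) by (simp add: N_iff)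
    qed
  qed
  moreover have "N (srefl i \<circ> w) \<subseteq> apos" "insert x (N w) \<subseteq> apos"
    using assms(3) by (auto simp: inversions_def)
  ultimately show ?thesis
    by blast
qed

section \<open>Abelian ideals and minuscule elements\<close>

definition D :: "'a set \<Rightarrow> 'a affine_space set" where
  "D I = {delta - embed \<gamma> | \<gamma>. \<gamma> \<in> I}"

lemma delta_minus_embed: "delta - embed \<gamma> = (- \<gamma>, 1, 0)"
  by (simp add: delta_def embed_def)

lemma D_iff: "(\<mu>, k, b) \<in> D I \<longleftrightarrow> - \<mu> \<in> I \<and> k = 1 \<and> b = 0"
  by (force simp: D_def delta_minus_embed)

lemma D_apos: "\<gamma> \<in> \<Delta> \<Longrightarrow> delta - embed \<gamma> \<in> apos"
  using aroots_intro[of "- \<gamma>" 1] aheight_pos[of "- \<gamma>" 1 0]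
  by (simp add: delta_minus_embed apos_iff uminus_root_iff)

lemma Ab_subset_Pos: "I \<in> Ab \<Longrightarrow> I \<subseteq> Pos"
  and Ab_finite: "I \<in> Ab \<Longrightarrow> finite I"
  using finite_Pos finite_subset by (auto simp: abelian_ideals_def upper_ideal_def)

lemma Ab_upper: "I \<in> Ab \<Longrightarrow> \<mu> \<in> I \<Longrightarrow> \<gamma> \<in> Pos \<Longrightarrow> (\<mu>, \<gamma>) \<in> root_order \<Delta> S \<Longrightarrow> \<gamma> \<in> I"
  unfolding abelian_ideals_def upper_ideal_def by blast

lemma Pos_add: "\<mu> \<in> Pos \<Longrightarrow> \<nu> \<in> Pos \<Longrightarrow> \<mu> + \<nu> \<in> \<Delta> \<Longrightarrow> \<mu> + \<nu> \<in> Pos"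
  using root_cone_add by (simp add: Pos_iff_cone)

lemma Ab_add: "I \<in> Ab \<Longrightarrow> \<mu> \<in> I \<Longrightarrow> \<nu> \<in> Pos \<Longrightarrow> \<mu> + \<nu> \<in> \<Delta> \<Longrightarrow> \<mu> + \<nu> \<in> I"
  using Ab_upper[of I \<mu> "\<mu> + \<nu>"] Pos_add root_order_add Ab_subset_Pos by blast

lemma Ab_abelian: "I \<in> Ab \<Longrightarrow> \<mu> \<in> I \<Longrightarrow> \<nu> \<in> I \<Longrightarrow> \<mu> + \<nu> \<notin> \<Delta>"
  using Pos_add[of \<mu> \<nu>] Ab_subset_Pos unfolding abelian_ideals_def by blast

text \<open>The root order is generated by additions of simple roots, so only these are checked. The
  abelian condition is asked for sums in \<Delta>, the form in which the affine arguments deliver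
  it.\<close>

lemma AbI:
  assumes "I \<subseteq> Pos"
    and up: "\<And>\<mu> s. \<mu> \<in> I \<Longrightarrow> s \<in> S \<Longrightarrow> \<mu> + s \<in> \<Delta> \<Longrightarrow> \<mu> + s \<in> I"
    and ab: "\<And>\<mu> \<nu>. \<mu> \<in> I \<Longrightarrow> \<nu> \<in> I \<Longrightarrow> \<mu> + \<nu> \<notin> \<Delta>"
  shows "I \<in> Ab"
proof -
  have "\<gamma> \<in> I" if "(\<mu>, \<gamma>) \<in> root_order \<Delta> S" "\<mu> \<in> I" for \<mu> \<gamma>
    using that unfolding root_order_def
  proof (induction rule: rtrancl_induct)
    case (step \<nu> \<gamma>)
    then show ?case
      using up[of \<nu> "\<gamma> - \<nu>"] Pos_subset by auto
  qed
  then show ?thesis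
    using assms(1) ab Pos_subset unfolding abelian_ideals_def upper_ideal_def by blast
qed

lemma empty_Ab: "{} \<in> Ab"
  by (rule AbI) auto

text \<open>A root \<gamma> of least height in J - I works: if \<gamma> = \<mu> + s with \<mu> \<in>
  J, then \<mu> is not in the upper ideal \<open>I\<close>, contradicting minimality. As \<gamma> is
  outside \<open>I\<close>, the smaller ideal still contains \<open>I\<close>.\<close>

lemma Ab_remove:
  assumes "J \<in> Ab" "I \<in> Ab" "I \<subset> J"
  obtains \<gamma> where "\<gamma> \<in> J - I" "J - {\<gamma>} \<in> Ab"
proof -
  have "finite (J - I)" "J - I \<noteq> {}"
    using assms Ab_finite by auto
  then obtain \<gamma> where \<gamma>: "\<gamma> \<in> J - I" and min: "\<And>\<mu>. \<mu> \<in> J - I \<Longrightarrow> height \<gamma> \<le> height \<mu>"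
    using ex_is_arg_min_if_finite[of "J - I" height] by (auto simp: is_arg_min_linorder)
  have "J - {\<gamma>} \<in> Ab"
  proof (rule AbI)
    fix \<mu> s
    assume \<mu>: "\<mu> \<in> J - {\<gamma>}" "s \<in> S" "\<mu> + s \<in> \<Delta>"
    have "\<mu> + s \<noteq> \<gamma>"
    proof
      assume eq: "\<mu> + s = \<gamma>"
      then have "\<mu> \<notin> I"
        using Ab_add[OF assms(2)] \<mu> \<gamma> S_subset_Pos by blast
      then have "height \<gamma> \<le> height \<mu>"
        using min \<mu> by blast
      then show False
        using eq \<mu>(2) height_simple by (auto simp: height_linear_simps)
    qed
    then show "\<mu> + s \<in> J - {\<gamma>}"
      using Ab_add[OF assms(1)] \<mu> S_subset_Pos by blast
  qed (use Ab_subset_Pos[OF assms(1)] Ab_abelian[OF assms(1)] in auto)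
  then show thesis
    using that \<gamma> by blast
qed

text \<open>Dually, take \<gamma> of greatest height in J - I: a root \<gamma> + s stays in
  \<open>J\<close>, hence lies in \<open>I\<close> by maximality. The abelian condition is inherited
  from \<open>J\<close>.\<close>

lemma Ab_insert:
  assumes "J \<in> Ab" "I \<in> Ab" "I \<subset> J"
  obtains \<gamma> where "\<gamma> \<in> J - I" "insert \<gamma> I \<in> Ab"
proof -
  have "finite (J - I)" "J - I \<noteq> {}"
    using assms Ab_finite by auto
  then obtain \<gamma> where \<gamma>: "\<gamma> \<in> J - I" and max: "\<And>\<mu>. \<mu> \<in> J - I \<Longrightarrow> - height \<gamma> \<le> - height \<mu>"
    using ex_is_arg_min_if_finite[of "J - I" "\<lambda>x. - height x"] unfolding is_arg_min_linorder
    by blast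
  have "insert \<gamma> I \<in> Ab"
  proof (rule AbI)
    fix \<mu> s
    assume \<mu>: "\<mu> \<in> insert \<gamma> I" "s \<in> S" "\<mu> + s \<in> \<Delta>"
    show "\<mu> + s \<in> insert \<gamma> I"
    proof (cases "\<mu> \<in> I")
      case True
      then show ?thesis
        using Ab_add[OF assms(2)] \<mu> S_subset_Pos by blast
    next
      case False
      then have "\<gamma> + s \<in> J" "\<mu> = \<gamma>"
        using Ab_add[OF assms(1), of \<gamma> s] \<mu> \<gamma> S_subset_Pos by auto
      moreover have "\<not> - height \<gamma> \<le> - height (\<gamma> + s)"
        using height_simple[OF \<mu>(2)] by (simp add: height_linear_simps)
      ultimately show ?thesis
        using max by blast
    qed
  next
    fix \<mu> \<nu>
    assume "\<mu> \<in> insert \<gamma> I" "\<nu> \<in> insert \<gamma> I"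
    then have "\<mu> \<in> J" "\<nu> \<in> J"
      using assms(3) \<gamma> by auto
    then show "\<mu> + \<nu> \<notin> \<Delta>"
      using Ab_abelian[OF assms(1)] by blast
  qed (use Ab_subset_Pos[OF assms(1)] assms(3) \<gamma> in auto)
  then show thesis
    using that \<gamma> by blast
qed

text \<open>The levels of \<open>p\<close> and \<open>q\<close> sum to 1 and neither is negative, so
  they are 0 and 1; this last case contradicts the ideal property.\<close>

lemma no_positive_splitting:
  assumes w: "w \<in> W" "N w = D J" and ideal: "insert \<gamma> J \<in> Ab" "\<gamma> \<notin> J"
    and p: "p \<in> aroots" "w p \<in> apos" and q: "q \<in> aroots" "w q \<in> apos"
  shows "p + q \<noteq> delta - embed \<gamma>"
proof
  assume sum: "p + q = delta - embed \<gamma>"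
  obtain \<mu> k where \<mu>: "\<mu> \<in> \<Delta>" "p = (\<mu>, of_int k, 0)"
    using p(1) by (rule aroots_cases)
  obtain \<nu> l where \<nu>: "\<nu> \<in> \<Delta>" "q = (\<nu>, of_int l, 0)"
    using q(1) by (rule aroots_cases)
  have "of_int (k + l) = (1::real)" and fin: "\<mu> + \<nu> = - \<gamma>"
    using sum by (simp_all add: \<mu> \<nu> delta_minus_embed)
  then have kl: "k + l = 1"
    by (simp only: of_int_eq_1_iff)
  have \<gamma>: "\<gamma> \<in> Pos"
    using Ab_subset_Pos[OF ideal(1)] by blast
  \<comment> \<open>The level of a root with positive image is nonnegative, as a root of negative level
    would be \<open>\<gamma>' - \<delta>\<close> with \<open>\<gamma>' \<in> J\<close>, making \<open>\<gamma> + \<gamma>'\<close> a root.\<close>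
  have level: "k' \<ge> 0"
    if "\<mu>' \<in> \<Delta>" "\<nu>' \<in> \<Delta>" "\<mu>' + \<nu>' = - \<gamma>" "w (\<mu>', of_int k', 0) \<in> apos" for \<mu>' \<nu>' k'
  proof (rule ccontr)
    assume "\<not> k' \<ge> 0"
    then have "aheight (\<mu>', of_int k', 0) < 0"
      using aheight_neg[OF that(1)] by simp
    then have "- (\<mu>', real_of_int k', 0) \<in> N w"
      using N_negD[OF w(1) aroots_intro[OF that(1)] _ that(4)] by (auto simp: apos_iff)
    then have "\<mu>' \<in> J"
      by (simp add: w(2) D_iff)
    moreover have "\<gamma> + \<mu>' = - \<nu>'"
      using that(3) by (metis add.commute add_minus_cancel minus_add_distrib minus_minus)
    ultimately show False
      using Ab_abelian[OF ideal(1), of \<gamma> \<mu>'] that(2) uminus_root_iff by simp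
  qed
  \<comment> \<open>The level-0 root \<mu>' is positive, since inversions have level 1. Hence
    \<gamma> + \<mu>' = -\<nu>' lies in the ideal and differs from \<gamma>, so it belongs to
    \<open>J\<close>, which makes \<nu>' + \<delta> an inversion.\<close>
  have zero: False
    if "\<mu>' \<in> \<Delta>" "\<nu>' \<in> \<Delta>" "\<mu>' + \<nu>' = - \<gamma>" "w (\<mu>', 0, 0) \<in> apos" "w (\<nu>', 1, 0) \<in> apos" for \<mu>' \<nu>'
  proof -
    have "\<mu>' \<in> Pos"
    proof (rule ccontr)
      assume "\<mu>' \<notin> Pos"
      then have "(\<mu>', of_int 0, 0) \<notin> apos"
        using that(1) by (simp add: apos_iff aheight_zero Pos_iff_height)
      then have "- (\<mu>', of_int 0, 0) \<in> N w"
        using N_negD[OF w(1) aroots_intro[OF that(1), of 0]] that(4) by simp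
      then show False
        by (simp add: w(2) D_iff)
    qed
    moreover have eq: "\<gamma> + \<mu>' = - \<nu>'"
      using that(3) by (metis add.commute add_minus_cancel minus_add_distrib minus_minus)
    ultimately have "- \<nu>' \<in> insert \<gamma> J"
      using Ab_add[OF ideal(1), of \<gamma> \<mu>'] that(2) uminus_root_iff by simp
    moreover have "- \<nu>' \<noteq> \<gamma>"
      using eq that(1) zero_notin_roots by auto
    ultimately have "(\<nu>', 1, 0) \<in> N w"
      by (simp add: w(2) D_iff)
    then show False
      using that(5) by (simp add: N_iff[OF w(1)])
  qed
  have "k \<ge> 0" "l \<ge> 0"
    using level[of \<mu> \<nu> k] level[of \<nu> \<mu> l] \<mu> \<nu> fin p q by (auto simp: add.commute)
  then consider "k = 0" "l = 1" | "k = 1" "l = 0"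
    using kl by linarith
  then show False
    using zero[of \<mu> \<nu>] zero[of \<nu> \<mu>] \<mu> \<nu> fin p q by cases (auto simp: add.commute)
qed

text \<open>A nonsimple positive image would split off a simple root. A real remainder is pulled
  back by \<open>w\<close> and excluded by \<open>no_positive_splitting\<close>; an imaginary one
  would put -\<gamma> into \<open>J\<close>.\<close>

lemma insert_image_simple:
  assumes w: "w \<in> W" "N w = D J" and ideal: "insert \<gamma> J \<in> Ab" "\<gamma> \<notin> J"
  obtains i where "i \<le> n" "w (delta - embed \<gamma>) = asimple i"
proof -
  have \<gamma>: "\<gamma> \<in> Pos" "\<gamma> \<in> \<Delta>"
    using Ab_subset_Pos[OF ideal(1)] Pos_subset by auto
  have "delta - embed \<gamma> \<notin> N w"
    using ideal(2) by (simp add: w(2) delta_minus_embed D_iff)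
  then have pos: "w (delta - embed \<gamma>) \<in> apos"
    using D_apos[OF \<gamma>(2)] N_iff[OF w(1)] by blast
  then show thesis
  proof (cases rule: apos_decompose)
    case (1 i)
    then show thesis using that by blast
  next
    case (2 i)
    define p q where "p = inv w (asimple i)" and "q = inv w (w (delta - embed \<gamma>) - asimple i)"
    have wpq: "w p = asimple i" "w q = w (delta - embed \<gamma>) - asimple i"
      by (simp_all add: p_def q_def W_inv_apply w(1))
    then have "w (p + q) = w (delta - embed \<gamma>)"
      by (simp add: W_add[OF w(1)])
    then have "p + q = delta - embed \<gamma>"
      using W_inj[OF w(1)] by blast
    moreover have "p \<in> aroots" "q \<in> aroots" "w p \<in> apos" "w q \<in> apos"
      using 2 wpq asimple_apos[of i] W_aroots[OF w(1), of p] W_aroots[OF w(1), of q]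
      by (auto simp: apos_iff)
    ultimately show thesis
      using no_positive_splitting[OF w ideal] by blast
  next
    case (3 i k)
    \<comment> \<open>This is the preimage of the simple root, because \<open>w\<close> fixes
      \<delta>. Its level is at most 0, so it is a negative root; the boundary case k = 1 uses that
      \<gamma> is positive.\<close>
    define y :: "'a affine_space" where "y = (- \<gamma>, of_int (1 - k), 0)"
    have "y = delta - embed \<gamma> - of_int k *\<^sub>R delta"
      by (simp add: y_def delta_minus_embed) (simp add: delta_def)
    then have "w y = w (delta - embed \<gamma>) - of_int k *\<^sub>R delta"
      by (simp only: W_diff[OF w(1)] linear_cmul[OF W_linear[OF w(1)]] W_delta[OF w(1)])
    then have "w y = asimple i"
      using 3(3) by (simp add: algebra_simps)
    then have wy: "w y \<in> apos"
      using 3 asimple_apos by simp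
    have y: "y \<in> aroots"
      unfolding y_def using \<gamma>(2) by (intro aroots_intro) (simp add: uminus_root_iff)
    have "aheight y < 0"
    proof (cases "k = 1")
      case True
      then show ?thesis
        using height_Pos[OF \<gamma>(1)] by (simp add: y_def aheight_zero height_linear_simps)
    next
      case False
      then show ?thesis
        unfolding y_def using \<gamma>(2) 3 by (intro aheight_neg) (simp_all add: uminus_root_iff)
    qed
    then have "- y \<in> N w"
      using N_negD[OF w(1) y _ wy] by (auto simp: apos_iff)
    then have "- \<gamma> \<in> J"
      by (simp add: w(2) y_def D_iff)
    then have "- \<gamma> \<in> Pos"
      using Ab_subset_Pos[OF ideal(1)] by blast
    then have False
      using height_Pos[OF \<gamma>(1)] height_Pos[of "- \<gamma>"] by (simp add: height_linear_simps)
    then show thesis ..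
  qed
qed

lemma N_insert_step:
  assumes w: "w \<in> W" "N w = D J" and \<gamma>: "\<gamma> \<in> \<Delta>"
    and i: "i \<le> n" "w (delta - embed \<gamma>) = asimple i"
  shows "N (srefl i \<circ> w) = D (insert \<gamma> J)"
proof -
  have "N (srefl i \<circ> w) = insert (delta - embed \<gamma>) (N w)"
    using N_step[OF w(1) i(1) D_apos[OF \<gamma>] i(2)] .
  then show ?thesis
    by (auto simp: w(2) D_def)
qed

text \<open>Peterson's theorem, existence part.\<close>

lemma minuscule_exists:
  assumes "I \<in> Ab"
  shows "\<exists>w\<in>W. N w = D I"
  using assms
proof (induction "card I" arbitrary: I)
  case 0
  then have "D I = {}"
    using Ab_finite by (auto simp: D_def)
  moreover have "N id = {}"
    using N_iff[OF affine_weyl.one] by auto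
  ultimately show ?case
    by (intro bexI[OF _ affine_weyl.one]) (simp only:)
next
  case (Suc m)
  then have "{} \<subset> I"
    by auto
  then obtain \<gamma> where \<gamma>: "\<gamma> \<in> I" "I - {\<gamma>} \<in> Ab"
    using Ab_remove[OF Suc.prems empty_Ab] by blast
  have "card (I - {\<gamma>}) = m"
    using Suc \<gamma> by simp
  then obtain w where w: "w \<in> W" "N w = D (I - {\<gamma>})"
    using Suc.hyps(1) \<gamma>(2) by blast
  have I: "insert \<gamma> (I - {\<gamma>}) = I"
    using \<gamma>(1) by blast
  then obtain i where i: "i \<le> n" "w (delta - embed \<gamma>) = asimple i"
    using insert_image_simple[OF w, of \<gamma>] Suc.prems by auto
  have "\<gamma> \<in> \<Delta>"
    using \<gamma>(1) Ab_subset_Pos[OF Suc.prems] Pos_subset by blast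
  then have "N (srefl i \<circ> w) = D I"
    using N_insert_step[OF w _ i] I by simp
  then show ?case
    using affine_weyl.step[OF i(1) w(1)] by blast
qed

section \<open>The minuscule element of an abelian ideal\<close>

abbreviation w_of :: "'a set \<Rightarrow> 'a affine_space \<Rightarrow> 'a affine_space" where
  "w_of \<equiv> minuscule_of \<Delta> n \<alpha> \<theta>"

lemma w_of:
  assumes "I \<in> Ab"
  shows "w_of I \<in> W" "N (w_of I) = D I"
proof -
  obtain w where w: "w \<in> W" "N w = D I"
    using minuscule_exists[OF assms] by blast
  have "I \<subseteq> \<Delta>"
    using Ab_subset_Pos[OF assms] Pos_subset by blast
  \<comment> \<open>The set witnessing \<open>minuscule\<close> can be \<open>I\<close> itself, so
    the description reduces to membership in \<open>W\<close> and the inversion set;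
    \<open>N_inject\<close> then makes it unique.\<close>
  then have m: "minuscule \<Delta> n \<alpha> \<theta> u \<and> N u = D I \<longleftrightarrow> u \<in> W \<and> N u = D I" for u
    unfolding minuscule_def S_eq[symmetric] D_def by blast
  have "w_of I = (THE u. u \<in> W \<and> N u = D I)"
    unfolding minuscule_of_def S_eq[symmetric] m[unfolded D_def] D_def ..
  also have "\<dots> = w"
    by (rule the_equality) (use w N_inject in auto)
  finally show "w_of I \<in> W" "N (w_of I) = D I"
    using w by auto
qed

lemma w_of_eqI: "w \<in> W \<Longrightarrow> I \<in> Ab \<Longrightarrow> N w = D I \<Longrightarrow> w_of I = w"
  using N_inject w_of by metis

section \<open>Shift vectors and covers\<close>

abbreviation shift_of :: "'a set \<Rightarrow> nat \<Rightarrow> int" where "shift_of \<equiv> shift \<Delta> n \<alpha> \<theta>"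

text \<open>The minus sign in the definition of the shift is absorbed by passing from \<mu> to
  -\<mu>, which is again a root.\<close>

lemma shift_eqI:
  assumes "\<mu> \<in> \<Delta>" "inv (w_of I) (asimple i) = (\<mu>, of_int k, 0)"
  shows "shift_of I i = k"
  unfolding shift_def
proof (rule the_equality)
  have "inv (w_of I) (asimple i) = - embed (- \<mu>) + of_int k *\<^sub>R delta"
    by (simp add: assms(2) embed_def delta_def)
  then show "\<exists>\<nu>\<in>\<Delta>. inv (w_of I) (asimple i) = - embed \<nu> + real_of_int k *\<^sub>R delta"
    using assms(1) uminus_root_iff by blast
next
  fix l
  assume "\<exists>\<nu>\<in>\<Delta>. inv (w_of I) (asimple i) = - embed \<nu> + real_of_int l *\<^sub>R delta"
  then show "l = k"
    by (auto simp: assms(2) embed_def delta_def)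
qed

lemma inv_w_of_asimple:
  assumes "I \<in> Ab" "i \<le> n"
  obtains \<mu> where "\<mu> \<in> \<Delta>" "inv (w_of I) (asimple i) = (\<mu>, of_int (shift_of I i), 0)"
proof -
  have "inv (w_of I) (asimple i) \<in> aroots"
    using W_aroots[OF W_inv[OF w_of(1)[OF assms(1)]]] asimple_aroots[OF assms(2)] by blast
  then obtain \<mu> k where "\<mu> \<in> \<Delta>" "inv (w_of I) (asimple i) = (\<mu>, of_int k, 0)"
    by (rule aroots_cases)
  then show thesis
    using that shift_eqI by blast
qed

section \<open>Removable and addable roots\<close>

definition removable :: "'a set \<Rightarrow> 'a set" where
  "removable I = {\<gamma> \<in> I. I - {\<gamma>} \<in> Ab}"

definition addable :: "'a set \<Rightarrow> 'a set" where
  "addable I = {\<gamma>. \<gamma> \<notin> I \<and> insert \<gamma> I \<in> Ab}"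

text \<open>If \<gamma> is removable, \<open>w_of I\<close> is \<open>srefl i\<close> after the
  element of I - {\<gamma>}, so its inverse sends \<open>asimple i\<close> to \<gamma> - \<delta>.
  Conversely, an obstruction to removal is \<gamma> = \<mu> + s with \<mu> \<in> I, which splits
  \<open>asimple i\<close> into two positive roots.\<close>

lemma removable_iff:
  assumes I: "I \<in> Ab"
  shows "\<gamma> \<in> removable I \<longleftrightarrow> (\<exists>i\<le>n. \<gamma> \<in> \<Delta> \<and> inv (w_of I) (asimple i) = (\<gamma>, -1, 0))"
proof
  note w = w_of[OF I]
  assume "\<gamma> \<in> removable I"
  then have \<gamma>: "\<gamma> \<in> I" "I - {\<gamma>} \<in> Ab" "\<gamma> \<in> \<Delta>" and ins: "insert \<gamma> (I - {\<gamma>}) = I"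
    using Ab_subset_Pos[OF I] Pos_subset by (auto simp: removable_def)
  note u = w_of[OF \<gamma>(2)]
  obtain i where i: "i \<le> n" "w_of (I - {\<gamma>}) (delta - embed \<gamma>) = asimple i"
    using insert_image_simple[OF u, of \<gamma>] ins I by auto
  have "N (srefl i \<circ> w_of (I - {\<gamma>})) = D I"
    using N_insert_step[OF u \<gamma>(3) i] ins by simp
  then have "w_of I = srefl i \<circ> w_of (I - {\<gamma>})"
    using w_of_eqI affine_weyl.step[OF i(1) u(1)] I by blast
  then have "w_of I (delta - embed \<gamma>) = - asimple i"
    using i by (simp add: srefl_asimple)
  then have "w_of I (- (delta - embed \<gamma>)) = asimple i"
    by (simp only: W_uminus[OF w(1)] minus_minus)
  then have "inv (w_of I) (asimple i) = (\<gamma>, -1, 0)"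
    using W_inv_eq_iff[OF w(1)] by (simp add: delta_minus_embed)
  then show "\<exists>i\<le>n. \<gamma> \<in> \<Delta> \<and> inv (w_of I) (asimple i) = (\<gamma>, -1, 0)"
    using i \<gamma> by blast
next
  note w = w_of[OF I]
  assume "\<exists>i\<le>n. \<gamma> \<in> \<Delta> \<and> inv (w_of I) (asimple i) = (\<gamma>, -1, 0)"
  then obtain i where i: "i \<le> n" "\<gamma> \<in> \<Delta>" "w_of I (\<gamma>, -1, 0) = asimple i"
    using W_inv_eq_iff[OF w(1)] by blast
  have neg: "(\<gamma>, -1, 0) = - (delta - embed \<gamma>)"
    by (simp add: delta_minus_embed)
  have img: "w_of I (delta - embed \<gamma>) = - asimple i"
    using i(3) unfolding neg W_uminus[OF w(1)] by (metis minus_minus)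
  then have "delta - embed \<gamma> \<in> N (w_of I)"
    using N_iff[OF w(1)] D_apos[OF i(2)] not_apos_neg[OF asimple_apos[OF i(1)]] by simp
  then have \<gamma>: "\<gamma> \<in> I"
    by (simp add: w(2) delta_minus_embed D_iff)
  have "I - {\<gamma>} \<in> Ab"
  proof (rule AbI)
    fix \<mu> s
    assume \<mu>: "\<mu> \<in> I - {\<gamma>}" "s \<in> S" "\<mu> + s \<in> \<Delta>"
    have "\<mu> + s \<noteq> \<gamma>"
    proof
      assume eq: "\<mu> + s = \<gamma>"
      have "embed s \<in> apos" "embed s \<notin> N (w_of I)"
        using \<mu>(2) S_subset_Pos by (auto simp: affine_pos_roots_def w(2) embed_def D_iff)
      then have s: "w_of I (embed s) \<in> apos"
        using N_iff[OF w(1)] by blast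
      have "delta - embed \<mu> \<in> N (w_of I)"
        using \<mu>(1) by (simp add: w(2) delta_minus_embed D_iff)
      then have "w_of I (delta - embed \<mu>) \<notin> apos" "w_of I (delta - embed \<mu>) \<in> aroots"
        using N_iff[OF w(1)] W_aroots[OF w(1)] apos_iff by blast+
      then have "- w_of I (delta - embed \<mu>) \<in> apos"
        using apos_or_neg by blast
      \<comment> \<open>Applying \<open>w_of I\<close> to this difference gives the forbidden
        splitting: \<delta> - \<mu> and \<delta> - \<gamma> are both inversions.\<close>
      moreover have "embed s = (delta - embed \<mu>) - (delta - embed \<gamma>)"
        by (simp add: delta_minus_embed embed_def zero_prod_def flip: eq)
      then have "w_of I (embed s) = w_of I (delta - embed \<mu>) - w_of I (delta - embed \<gamma>)"
        by (simp only: W_diff[OF w(1)])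
      then have "w_of I (embed s) + - w_of I (delta - embed \<mu>) = asimple i"
        by (simp add: img)
      ultimately show False
        using asimple_indecomposable[OF i(1)] aheight_apos s by blast
    qed
    then show "\<mu> + s \<in> I - {\<gamma>}"
      using Ab_add[OF I] \<mu> S_subset_Pos by blast
  qed (use Ab_subset_Pos[OF I] Ab_abelian[OF I] in auto)
  then show "\<gamma> \<in> removable I"
    using \<gamma> by (simp add: removable_def)
qed

text \<open>One direction is \<open>insert_image_simple\<close>. For the other, each of the
  obstructions \<gamma> negative, \<gamma> + s missing, and \<gamma> + \<mu> a root with \<mu> \<in>
  I writes \<open>asimple i\<close> as a sum of two elements of height at least 1.\<close>

lemma addable_iff:
  assumes I: "I \<in> Ab"
  shows "\<gamma> \<in> addable I \<longleftrightarrow> (\<exists>i\<le>n. \<gamma> \<in> \<Delta> \<and> inv (w_of I) (asimple i) = (- \<gamma>, 1, 0))"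
proof
  note w = w_of[OF I]
  assume "\<gamma> \<in> addable I"
  then have \<gamma>: "\<gamma> \<notin> I" "insert \<gamma> I \<in> Ab"
    by (auto simp: addable_def)
  obtain i where i: "i \<le> n" "w_of I (delta - embed \<gamma>) = asimple i"
    using insert_image_simple[OF w \<gamma>(2,1)] .
  moreover have "\<gamma> \<in> \<Delta>"
    using Ab_subset_Pos[OF \<gamma>(2)] Pos_subset by blast
  ultimately show "\<exists>i\<le>n. \<gamma> \<in> \<Delta> \<and> inv (w_of I) (asimple i) = (- \<gamma>, 1, 0)"
    using W_inv_eq_iff[OF w(1)] by (metis delta_minus_embed)
next
  note w = w_of[OF I]
  assume "\<exists>i\<le>n. \<gamma> \<in> \<Delta> \<and> inv (w_of I) (asimple i) = (- \<gamma>, 1, 0)"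
  then obtain i where i: "i \<le> n" "\<gamma> \<in> \<Delta>" and img: "w_of I (delta - embed \<gamma>) = asimple i"
    using W_inv_eq_iff[OF w(1)] by (metis delta_minus_embed)
  have "delta - embed \<gamma> \<notin> N (w_of I)"
    using N_iff[OF w(1)] img asimple_apos[OF i(1)] by simp
  then have "\<gamma> \<notin> I"
    by (simp add: w(2) delta_minus_embed D_iff)
  \<comment> \<open>Inversions have level 1, so finite positive roots keep positive images.\<close>
  have Pos_image: "w_of I (embed \<mu>) \<in> apos" if "\<mu> \<in> Pos" for \<mu>
  proof -
    have "embed \<mu> \<in> apos" "embed \<mu> \<notin> N (w_of I)"
      using that by (auto simp: affine_pos_roots_def w(2) embed_def D_iff)
    then show ?thesis
      using N_iff[OF w(1)] by blast
  qed
  have \<gamma>: "\<gamma> \<in> Pos"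
  proof (rule ccontr)
    assume "\<gamma> \<notin> Pos"
    then have "w_of I (embed (- \<gamma>)) \<in> apos"
      using pos_or_neg[OF i(2)] Pos_image by blast
    moreover have "delta + embed (- \<gamma>) = delta - embed \<gamma>"
      by (simp add: embed_def delta_def)
    then have "delta + w_of I (embed (- \<gamma>)) = asimple i"
      using W_add[OF w(1), of delta "embed (- \<gamma>)"] by (simp add: img W_delta[OF w(1)])
    moreover have "aheight delta \<ge> 1"
      using height_theta by (simp add: aheight_delta)
    ultimately show False
      using asimple_indecomposable[OF i(1)] aheight_apos by blast
  qed
  have "insert \<gamma> I \<in> Ab"
  proof (rule AbI)
    fix \<mu> s
    assume \<mu>: "\<mu> \<in> insert \<gamma> I" "s \<in> S" "\<mu> + s \<in> \<Delta>"
    show "\<mu> + s \<in> insert \<gamma> I"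
    proof (cases "\<mu> \<in> I")
      case True
      then show ?thesis
        using Ab_add[OF I] \<mu> S_subset_Pos by blast
    next
      case False
      show ?thesis
      proof (rule ccontr)
        assume nin: "\<mu> + s \<notin> insert \<gamma> I"
        have \<mu>\<gamma>: "\<mu> = \<gamma>"
          using False \<mu>(1) by blast
        have "delta - embed (\<mu> + s) \<notin> N (w_of I)"
          unfolding w(2) delta_minus_embed D_iff minus_minus using nin by blast
        then have "w_of I (delta - embed (\<mu> + s)) \<in> apos"
          using D_apos[OF \<mu>(3)] N_iff[OF w(1)] by blast
        moreover have "w_of I (embed s) \<in> apos"
          using Pos_image \<mu>(2) S_subset_Pos by blast
        moreover have "delta - embed (\<mu> + s) + embed s = delta - embed \<gamma>"
          by (simp add: \<mu>\<gamma> embed_def delta_def)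
        then have "w_of I (delta - embed (\<mu> + s)) + w_of I (embed s) = asimple i"
          using W_add[OF w(1)] img by metis
        ultimately show False
          using asimple_indecomposable[OF i(1)] aheight_apos by blast
      qed
    qed
  next
    have mixed: "\<gamma> + \<mu> \<notin> \<Delta>" if \<mu>: "\<mu> \<in> I" for \<mu>
    proof
      assume root: "\<gamma> + \<mu> \<in> \<Delta>"
      \<comment> \<open>At level 2 the root \<open>y\<close> is positive but not an inversion, while
        \<delta> - \<mu> is one, and y - (\<delta> - \<mu>) = \<delta> - \<gamma>.\<close>
      define y :: "'a affine_space" where "y = (- (\<gamma> + \<mu>), 2, 0)"
      have "y \<in> apos"
        using root aroots_intro[of "- (\<gamma> + \<mu>)" 2] aheight_pos[of "- (\<gamma> + \<mu>)" 2 0]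
        unfolding y_def apos_iff uminus_root_iff by simp
      moreover have "y \<notin> N (w_of I)"
        by (simp add: y_def w(2) D_iff)
      ultimately have y: "w_of I y \<in> apos"
        using N_iff[OF w(1)] by blast
      have "delta - embed \<mu> \<in> N (w_of I)"
        using \<mu> by (simp add: w(2) delta_minus_embed D_iff)
      then have "w_of I (delta - embed \<mu>) \<notin> apos" "w_of I (delta - embed \<mu>) \<in> aroots"
        using N_iff[OF w(1)] W_aroots[OF w(1)] apos_iff by blast+
      then have "- w_of I (delta - embed \<mu>) \<in> apos"
        using apos_or_neg by blast
      moreover have "y - (delta - embed \<mu>) = delta - embed \<gamma>"
        by (simp add: y_def embed_def delta_def)
      then have "w_of I y + - w_of I (delta - embed \<mu>) = asimple i"
        using W_diff[OF w(1), of y "delta - embed \<mu>"] img by simp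
      ultimately show False
        using asimple_indecomposable[OF i(1)] aheight_apos y by blast
    qed
    have double: "\<gamma> + \<gamma> \<notin> \<Delta>"
      using reduced i(2) unfolding reduced_roots_def by (fastforce simp flip: scaleR_2)
    fix \<mu> \<nu>
    assume "\<mu> \<in> insert \<gamma> I" "\<nu> \<in> insert \<gamma> I"
    then show "\<mu> + \<nu> \<notin> \<Delta>"
      using mixed[of \<mu>] mixed[of \<nu>] double Ab_abelian[OF I, of \<mu> \<nu>]
      by (auto simp: add.commute)
  qed (use Ab_subset_Pos[OF I] \<gamma> in auto)
  then show "\<gamma> \<in> addable I"
    using \<open>\<gamma> \<notin> I\<close> by (simp add: addable_def)
qed

text \<open>Once the level is fixed, the finite part determines the whole affine root, and
  \<open>w_of I\<close> recovers the simple root from it.\<close>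

lemma inj_inv_w_of_asimple:
  assumes "I \<in> Ab"
  shows "inj_on (\<lambda>i. fst (inv (w_of I) (asimple i))) {i\<in>{0..n}. shift_of I i = k}"
proof (rule inj_onI)
  fix i j
  assume i: "i \<in> {i\<in>{0..n}. shift_of I i = k}" and j: "j \<in> {i\<in>{0..n}. shift_of I i = k}"
    and eq: "fst (inv (w_of I) (asimple i)) = fst (inv (w_of I) (asimple j))"
  obtain \<mu> \<nu> where "inv (w_of I) (asimple i) = (\<mu>, of_int (shift_of I i), 0)"
    "inv (w_of I) (asimple j) = (\<nu>, of_int (shift_of I j), 0)"
    using inv_w_of_asimple[OF assms] i j by (metis (no_types, lifting) atLeastAtMost_iff mem_Collect_eq)
  then have "inv (w_of I) (asimple i) = inv (w_of I) (asimple j)"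
    using i j eq by simp
  then have "asimple i = asimple j"
    using W_inv_apply(1)[OF w_of(1)[OF assms]] by metis
  then show "i = j"
    using inj_asimple i j by (auto simp: inj_on_def)
qed

text \<open>Trades a count of indices for a count of roots, the form in which removable and addable
  roots are described.\<close>

lemma card_shift:
  assumes "I \<in> Ab"
  shows "card {i\<in>{0..n}. shift_of I i = k} =
    card {\<mu> \<in> \<Delta>. \<exists>i\<le>n. inv (w_of I) (asimple i) = (\<mu>, of_int k, 0)}"
proof -
  have "(\<lambda>i. fst (inv (w_of I) (asimple i))) ` {i\<in>{0..n}. shift_of I i = k} =
      {\<mu> \<in> \<Delta>. \<exists>i\<le>n. inv (w_of I) (asimple i) = (\<mu>, of_int k, 0)}" (is "?f ` ?A = ?B")
  proof (intro equalityI subsetI)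
    fix \<mu> assume "\<mu> \<in> ?f ` ?A"
    then obtain i where "i \<le> n" "shift_of I i = k" "\<mu> = ?f i"
      by auto
    then show "\<mu> \<in> ?B"
      by (rule_tac inv_w_of_asimple[OF assms, of i]) auto
  next
    fix \<mu> assume "\<mu> \<in> ?B"
    then obtain i where i: "\<mu> \<in> \<Delta>" "i \<le> n" "inv (w_of I) (asimple i) = (\<mu>, of_int k, 0)"
      by blast
    then have "shift_of I i = k"
      using shift_eqI by blast
    then show "\<mu> \<in> ?f ` ?A"
      using i by (intro image_eqI[of _ _ i]) auto
  qed
  then show ?thesis
    using card_image[OF inj_inv_w_of_asimple[OF assms, of k]] by simp
qed

text \<open>\<open>Ab_remove\<close> fits some I - {\<gamma>} between any smaller ideal and
  \<open>I\<close>, so a covered ideal lacks exactly one root; conversely, no set lies strictly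
  between \<open>I\<close> and I - {\<gamma>}.\<close>

lemma kappa_removable:
  assumes I: "I \<in> Ab"
  shows "kappa Ab I = card (removable I)"
proof -
  have "{J. covers_in Ab I J} = (\<lambda>\<gamma>. I - {\<gamma>}) ` removable I"
  proof (intro equalityI subsetI)
    fix J assume "J \<in> {J. covers_in Ab I J}"
    then have J: "J \<in> Ab" "J \<subset> I" "\<not> (\<exists>K\<in>Ab. J \<subset> K \<and> K \<subset> I)"
      by (auto simp: covers_in_def)
    then obtain \<gamma> where \<gamma>: "\<gamma> \<in> I - J" "I - {\<gamma>} \<in> Ab"
      using Ab_remove[OF I] by blast
    then have "J \<subseteq> I - {\<gamma>}" "I - {\<gamma>} \<subset> I"
      using J(2) by auto
    then have "J = I - {\<gamma>}"
      using J(3) \<gamma>(2) by (metis psubsetI)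
    then show "J \<in> (\<lambda>\<gamma>. I - {\<gamma>}) ` removable I"
      using \<gamma> by (auto simp: removable_def)
  next
    fix J assume "J \<in> (\<lambda>\<gamma>. I - {\<gamma>}) ` removable I"
    then show "J \<in> {J. covers_in Ab I J}"
      using I by (auto simp: covers_in_def removable_def)
  qed
  moreover have "inj_on (\<lambda>\<gamma>. I - {\<gamma>}) (removable I)"
    by (auto simp: inj_on_def removable_def)
  ultimately show ?thesis
    by (simp add: kappa_def card_image)
qed

lemma iota_addable:
  assumes I: "I \<in> Ab"
  shows "iota Ab I = card (addable I)"
proof -
  have "{J. covers_in Ab J I} = (\<lambda>\<gamma>. insert \<gamma> I) ` addable I"
  proof (intro equalityI subsetI)
    fix J assume "J \<in> {J. covers_in Ab J I}"
    then have J: "J \<in> Ab" "I \<subset> J" "\<not> (\<exists>K\<in>Ab. I \<subset> K \<and> K \<subset> J)"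
      by (auto simp: covers_in_def)
    then obtain \<gamma> where \<gamma>: "\<gamma> \<in> J - I" "insert \<gamma> I \<in> Ab"
      using Ab_insert[OF _ I] by blast
    then have "J = insert \<gamma> I"
      using J by blast
    then show "J \<in> (\<lambda>\<gamma>. insert \<gamma> I) ` addable I"
      using \<gamma> by (auto simp: addable_def)
  next
    fix J assume "J \<in> (\<lambda>\<gamma>. insert \<gamma> I) ` addable I"
    then show "J \<in> {J. covers_in Ab J I}"
      using I by (auto simp: covers_in_def addable_def)
  qed
  moreover have "inj_on (\<lambda>\<gamma>. insert \<gamma> I) (addable I)"
    by (auto simp: inj_on_def addable_def)
  ultimately show ?thesis
    by (simp add: iota_def card_image)
qed

lemma kappa_shift:
  assumes I: "I \<in> Ab"
  shows "kappa Ab I = card {i\<in>{0..n}. shift_of I i = -1}"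
proof -
  have "removable I = {\<mu> \<in> \<Delta>. \<exists>i\<le>n. inv (w_of I) (asimple i) = (\<mu>, of_int (-1), 0)}"
    using removable_iff[OF I] by auto
  then show ?thesis
    using kappa_removable[OF I] card_shift[OF I, of "-1"] by simp
qed

lemma iota_shift:
  assumes I: "I \<in> Ab"
  shows "iota Ab I = card {i\<in>{0..n}. shift_of I i = 1}"
proof -
  \<comment> \<open>An addable \<gamma> occurs here with finite part -\<gamma>, so the two sets are
    matched through negation.\<close>
  let ?B = "{\<mu> \<in> \<Delta>. \<exists>i\<le>n. inv (w_of I) (asimple i) = (\<mu>, of_int 1, 0)}"
  have "\<gamma> \<in> addable I \<longleftrightarrow> - \<gamma> \<in> ?B" for \<gamma>
    using addable_iff[OF I, of \<gamma>] uminus_root_iff[of \<gamma>] by auto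
  then have "uminus ` addable I = ?B"
    by (force intro: image_eqI[of _ uminus "- _"])
  then have "card (addable I) = card ?B"
    using card_image[of uminus "addable I"] by (metis inj_uminus)
  then show ?thesis
    using iota_addable[OF I] card_shift[OF I, of 1] by simp
qed

end

theorem theorem4p4:
  fixes \<Delta> S I :: "'a::euclidean_space set" and n :: nat
    and \<alpha> :: "nat \<Rightarrow> 'a" and \<theta> :: 'a
  assumes "root_system \<Delta>" and "reduced_roots \<Delta>" and "irreducible_roots \<Delta>"
    and "simple_roots \<Delta> S" and "S = \<alpha> ` {1..n}" and "inj_on \<alpha> {1..n}"
    and "highest_root \<Delta> S \<theta>"
    and "I \<in> abelian_ideals \<Delta> S"
  shows "kappa (abelian_ideals \<Delta> S) I = card {i\<in>{0..n}. shift \<Delta> n \<alpha> \<theta> I i = -1} \<and>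
         iota (abelian_ideals \<Delta> S) I = card {i\<in>{0..n}. shift \<Delta> n \<alpha> \<theta> I i = 1}"
proof -
  interpret affine_root_datum \<Delta> S n \<alpha> \<theta>
    using assms(1,2,4-7) by unfold_locales
  show ?thesis
    using kappa_shift[OF assms(8)] iota_shift[OF assms(8)] by (rule conjI)
qed

end
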